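(* Fix an integer $k\ge 2$, constants $\alpha>0$, $r>0$, $0<p<1$, and let $X$ be the number of solutions of a random instance of Model RB with parameters $(n,\alpha,r,k,p)$. Let $\tau=e^{1/r}$ and $p_{cr}=1-\frac{1}{\tau}$. If $(2k-1)\alpha>1$ and $k\ge \frac{\tau\ln\tau}{\tau-1}$, then $\lim_{n\to\infty}\Pr[X>0]=1$ if $p<p_{cr}$, and $\lim_{n\to\infty}\Pr[X>0]=0$ if $p>p_{cr}$.
   Context: Model RB with parameters $(n,\alpha,r,k,p)$, where $n$ is the number of variables, $\alpha>0$, $r>0$, $k\ge 2$ an integer and $0<p<1$: there are $n$ variables $x_1,\dots,x_n$, each with the same domain $D$ of size $d=n^{\alpha}$ (treated as an integer). A random instance is generated as follows: (1) select, independently with repetition, $t=rn\ln d$ constraints, the scope of each being a set of $k$ distinct variables chosen uniformly at random among the $n$ variables; (2) for each constraint, select uniformly at random without repetition a set of $q=p\,d^{k}$ "incompatible" tuples from $D^{k}$ (so the constraint's relation consists of the remaining $(1-p)d^k$ tuples). An assignment of values from $D$ to all variables is a solution if, for every constraint, the tuple of values assigned to its scope is not incompatible. Limits are taken as $n\to\infty$ with $\alpha,r,k,p$ fixed. *)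

theory Defs
  imports "HOL-Probability.Probability"
begin

text \<open>Model RB. Variables are 0..<n, domain values are 0..<d.
  A constraint is a pair (scope, incompatible tuples); the scope is a k-element
  set of variables, and a tuple over the scope lists the values of the scope
  variables in increasing variable order.\<close>

definition rb_d :: "real \<Rightarrow> nat \<Rightarrow> nat" where
  "rb_d \<alpha> n = nat \<lfloor>real n powr \<alpha>\<rfloor>"

definition rb_t :: "real \<Rightarrow> real \<Rightarrow> nat \<Rightarrow> nat" where
  "rb_t \<alpha> r n = nat \<lfloor>r * real n * ln (real (rb_d \<alpha> n))\<rfloor>"

definition rb_q :: "real \<Rightarrow> nat \<Rightarrow> real \<Rightarrow> nat \<Rightarrow> nat" where
  "rb_q \<alpha> k p n = nat \<lfloor>p * real (rb_d \<alpha> n) ^ k\<rfloor>"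

definition rb_scopes :: "nat \<Rightarrow> nat \<Rightarrow> nat set set" where
  "rb_scopes n k = {S. S \<subseteq> {0..<n} \<and> card S = k}"

definition rb_tuples :: "nat \<Rightarrow> nat \<Rightarrow> nat list set" where
  "rb_tuples d k = {xs. length xs = k \<and> set xs \<subseteq> {0..<d}}"

definition rb_constraint :: "nat \<Rightarrow> real \<Rightarrow> nat \<Rightarrow> real \<Rightarrow> (nat set \<times> nat list set) pmf" where
  "rb_constraint n \<alpha> k p =
     do { S \<leftarrow> pmf_of_set (rb_scopes n k);
          R \<leftarrow> pmf_of_set {R. R \<subseteq> rb_tuples (rb_d \<alpha> n) k \<and> card R = rb_q \<alpha> k p n};
          return_pmf (S, R) }"

definition rb_instance :: "nat \<Rightarrow> real \<Rightarrow> real \<Rightarrow> nat \<Rightarrow> real \<Rightarrow> (nat \<Rightarrow> nat set \<times> nat list set) pmf" where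
  "rb_instance n \<alpha> r k p = Pi_pmf {..<rb_t \<alpha> r n} ({}, {}) (\<lambda>_. rb_constraint n \<alpha> k p)"

definition rb_is_solution :: "nat \<Rightarrow> (nat \<Rightarrow> nat set \<times> nat list set) \<Rightarrow> (nat \<Rightarrow> nat) \<Rightarrow> bool" where
  "rb_is_solution t C \<sigma> \<longleftrightarrow>
     (\<forall>i<t. map \<sigma> (sorted_list_of_set (fst (C i))) \<notin> snd (C i))"

definition rb_num_solutions :: "nat \<Rightarrow> real \<Rightarrow> real \<Rightarrow> (nat \<Rightarrow> nat set \<times> nat list set) \<Rightarrow> nat" where
  "rb_num_solutions n \<alpha> r C =
     card {\<sigma> \<in> {0..<n} \<rightarrow>\<^sub>E {0..<rb_d \<alpha> n}. rb_is_solution (rb_t \<alpha> r n) C \<sigma>}"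

definition rb_prob_sat :: "nat \<Rightarrow> real \<Rightarrow> real \<Rightarrow> nat \<Rightarrow> real \<Rightarrow> real" where
  "rb_prob_sat n \<alpha> r k p =
     measure_pmf.prob (rb_instance n \<alpha> r k p) {C. rb_num_solutions n \<alpha> r C > 0}"

end

theory Submission
  imports Defs "HOL-Real_Asymp.Real_Asymp"
begin

text \<open>Above the threshold the expected number of solutions tends to \<open>0\<close>. Below it, apply the second
  moment method: the ratio of \<open>E X\<^sup>2\<close> to \<open>(E X)\<^sup>2\<close> is the expectation of \<open>(1 + A * Y)\<^sup>t\<close>, where
  \<open>A \<le> p / (1 - p)\<close> and \<open>Y\<close> is the probability that a random scope lies in the agreement set of
  two random assignments, centered and rescaled by \<open>N / (N - 1)\<close> with \<open>N = d\<^sup>k\<close>. The overlap is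
  binomial with mean \<open>n / d\<close>. The centering comes from drawing incompatible tuples without
  repetition; it makes overlaps up to \<open>n * d powr (\<eta> - 1)\<close> contribute \<open>1 + o(1)\<close> as soon as
  \<open>(2 * k - 1) * \<alpha> > 1\<close>. Larger overlaps \<open>n * x\<close> contribute \<open>o(1)\<close> because
  \<open>r * ln (1 + A * x ^ k) < x\<close> on \<open>(0, 1]\<close>.\<close>

subsection \<open>Moments of the number of solutions\<close>

lemma measure_pmf_of_subsets_disjoint:
  assumes "finite T" "U \<subseteq> T" "q \<le> card T"
  shows "measure_pmf.prob (pmf_of_set {R. R \<subseteq> T \<and> card R = q}) {R. R \<inter> U = {}} =
    real ((card T - card U) choose q) / real (card T choose q)"
proof -
  let ?F = "{R. R \<subseteq> T \<and> card R = q}"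
  have card: "card ?F = card T choose q" using n_subsets[OF assms(1)] by simp
  have ne: "?F \<noteq> {}" using card assms(3) by (metis binomial_eq_0_iff card.empty leD)
  have fin: "finite ?F" using assms(1) by (auto intro: finite_subset[of _ "Pow T"])
  have "?F \<inter> {R. R \<inter> U = {}} = {R. R \<subseteq> T - U \<and> card R = q}" by auto
  moreover have "card \<dots> = (card T - card U) choose q"
    using n_subsets[of "T - U" q] assms by (simp add: card_Diff_subset finite_subset)
  ultimately show ?thesis using measure_pmf_of_set[OF ne fin] card by simp
qed

lemma measure_pmf_of_subsets_subset:
  assumes "finite T" "G \<subseteq> T" "k \<le> card T"
  shows "measure_pmf.prob (pmf_of_set {S. S \<subseteq> T \<and> card S = k}) {S. S \<subseteq> G} =
    real (card G choose k) / real (card T choose k)"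
proof -
  let ?F = "{S. S \<subseteq> T \<and> card S = k}"
  have card: "card ?F = card T choose k" using n_subsets[OF assms(1)] by simp
  have ne: "?F \<noteq> {}" using card assms(3) by (metis binomial_eq_0_iff card.empty leD)
  have fin: "finite ?F" using assms(1) by (auto intro: finite_subset[of _ "Pow T"])
  have "?F \<inter> {S. S \<subseteq> G} = {S. S \<subseteq> G \<and> card S = k}" using assms(2) by auto
  moreover have "card \<dots> = card G choose k"
    using n_subsets[of G k] assms finite_subset by blast
  ultimately show ?thesis using measure_pmf_of_set[OF ne fin] card by simp
qed

lemma choose_ratio_1:
  assumes "q < N"
  shows "real ((N - 1) choose q) / real (N choose q) = (real N - real q) / real N"
proof -
  have "(N - q) * (N choose q) = N * ((N - 1) choose q)" by (rule binomial_absorb_comp)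
  then have "(real N - real q) * real (N choose q) = real N * real ((N - 1) choose q)"
    using assms by (metis of_nat_diff of_nat_mult less_imp_le)
  moreover have "real (N choose q) > 0" using assms by simp
  ultimately show ?thesis using assms by (simp add: field_simps)
qed

text \<open>The two forbidden elements are peeled off one at a time, with
  \<open>choose_ratio_1\<close> for \<open>N\<close> and then for \<open>N - 1\<close>.\<close>

lemma choose_ratio_2:
  assumes "q < N" "2 \<le> N"
  shows "real ((N - 2) choose q) / real (N choose q) =
    (real N - real q) * (real N - real q - 1) / (real N * (real N - 1))"
proof (cases "q < N - 1")
  case True
  have "real ((N - 1 - 1) choose q) / real ((N - 1) choose q) = (real (N - 1) - real q) / real (N - 1)"
    by (rule choose_ratio_1) fact
  moreover have "N - 1 - 1 = N - 2" by simp
  moreover have "real ((N - 1) choose q) \<noteq> 0" using True by simp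
  ultimately have "real ((N - 2) choose q) / real (N choose q) =
      (real (N - 1) - real q) / real (N - 1) * (real ((N - 1) choose q) / real (N choose q))"
    by (simp add: field_simps)
  also have "\<dots> = (real (N - 1) - real q) / real (N - 1) * ((real N - real q) / real N)"
    using choose_ratio_1[OF assms(1)] by simp
  finally show ?thesis using assms by (simp add: of_nat_diff algebra_simps)
next
  \<comment> \<open>Here \<open>q = N - 1\<close>: no \<open>q\<close>-subset avoids two elements,
    and the factor \<open>real N - real q - 1\<close> vanishes too.\<close>
  case False
  then have "q = N - 1" using assms by simp
  then have "(N - 2) choose q = 0" "real N - real q - 1 = 0"
    using assms(2) by (simp_all add: of_nat_diff)
  then show ?thesis by simp
qed

lemma measure_pmf_of_subsets_notin:
  assumes "finite T" "x \<in> T" "q < card T"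
  shows "measure_pmf.prob (pmf_of_set {R. R \<subseteq> T \<and> card R = q}) {R. x \<notin> R} =
    (real (card T) - real q) / real (card T)"
  using measure_pmf_of_subsets_disjoint[of T "{x}" q] choose_ratio_1[of q "card T"] assms by simp

text \<open>Drawing without repetition lowers the second factor from \<open>(N - q) / N\<close> to
  \<open>(N - q - 1) / (N - 1)\<close>, with \<open>N\<close> the size of \<open>T\<close>. The
  centering of the overlap below stems from this factor.\<close>

lemma measure_pmf_of_subsets_notin_notin:
  assumes "finite T" "x \<in> T" "y \<in> T" "x \<noteq> y" "q < card T"
  shows "measure_pmf.prob (pmf_of_set {R. R \<subseteq> T \<and> card R = q}) {R. x \<notin> R \<and> y \<notin> R} =
    (real (card T) - real q) * (real (card T) - real q - 1) / (real (card T) * (real (card T) - 1))"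
proof -
  have "card {x, y} \<le> card T" using assms by (intro card_mono) auto
  then have "2 \<le> card T" using assms(4) by simp
  moreover have "{R. R \<inter> {x, y} = {}} = {R. x \<notin> R \<and> y \<notin> R}" by auto
  ultimately show ?thesis
    using measure_pmf_of_subsets_disjoint[of T "{x, y}" q] choose_ratio_2[of q "card T"] assms
    by (simp add: numeral_2_eq_2)
qed

section \<open>Probability that a random constraint is satisfied\<close>

lemma measure_pair_pmf_eq_expectation:
  fixes A :: "'a pmf" and B :: "'b pmf"
  shows
  "measure_pmf.prob (pair_pmf A B) X =
    measure_pmf.expectation A (\<lambda>x. measure_pmf.prob B {y. (x, y) \<in> X})"
proof -
  have "ennreal (measure_pmf.prob (pair_pmf A B) X) = emeasure (pair_pmf A B) X"
    by (simp add: measure_pmf.emeasure_eq_measure)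
  also have "\<dots> = (\<integral>\<^sup>+x. emeasure (bind_pmf B (\<lambda>y. return_pmf (x, y))) X \<partial>measure_pmf A)"
    unfolding pair_pmf_def by simp
  also have "\<dots> = (\<integral>\<^sup>+x. ennreal (measure_pmf.prob B {y. (x, y) \<in> X}) \<partial>measure_pmf A)"
  proof (rule nn_integral_cong)
    fix x :: 'a
    have "bind_pmf B (\<lambda>y. return_pmf (x, y)) = map_pmf (Pair x) B" by (simp add: map_pmf_def)
    then have "emeasure (bind_pmf B (\<lambda>y. return_pmf (x, y))) X = emeasure B (Pair x -` X)" by simp
    then show "emeasure (bind_pmf B (\<lambda>y. return_pmf (x, y))) X = ennreal (measure_pmf.prob B {y. (x, y) \<in> X})"
      by (simp add: vimage_def measure_pmf.emeasure_eq_measure)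
  qed
  also have "\<dots> = ennreal (measure_pmf.expectation A (\<lambda>x. measure_pmf.prob B {y. (x, y) \<in> X}))"
    by (intro nn_integral_eq_integral measure_pmf.integrable_const_bound[where B=1]) auto
  finally show ?thesis by (simp add: integral_nonneg_AE)
qed

lemma rb_constraint_eq_pair_pmf:
  "rb_constraint n \<alpha> k p = pair_pmf (pmf_of_set (rb_scopes n k))
     (pmf_of_set {R. R \<subseteq> rb_tuples (rb_d \<alpha> n) k \<and> card R = rb_q \<alpha> k p n})"
  unfolding rb_constraint_def pair_pmf_def ..

lemma finite_rb_tuples: "finite (rb_tuples d k)"
  and card_rb_tuples: "card (rb_tuples d k) = d ^ k"
proof -
  have eq: "rb_tuples d k = {xs. set xs \<subseteq> {0..<d} \<and> length xs = k}" by (auto simp: rb_tuples_def)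
  show "finite (rb_tuples d k)" unfolding eq by (rule finite_lists_length_eq) simp
  show "card (rb_tuples d k) = d ^ k" unfolding eq by (subst card_lists_length_eq) auto
qed

lemma rb_scopes_ne: "k \<le> n \<Longrightarrow> rb_scopes n k \<noteq> {}"
  and finite_rb_scopes: "finite (rb_scopes n k)"
proof -
  have "card (rb_scopes n k) = n choose k" using n_subsets[of "{0..<n}" k] by (simp add: rb_scopes_def)
  then show "k \<le> n \<Longrightarrow> rb_scopes n k \<noteq> {}" by (metis binomial_eq_0_iff card.empty leD)
  show "finite (rb_scopes n k)" unfolding rb_scopes_def
    by (rule finite_subset[of _ "Pow {0..<n}"]) auto
qed

lemma map_scope_in_rb_tuples:
  assumes "S \<in> rb_scopes n k" "\<sigma> \<in> {0..<n} \<rightarrow>\<^sub>E {0..<d}"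
  shows "map \<sigma> (sorted_list_of_set S) \<in> rb_tuples d k"
  using assms finite_subset[of S "{0..<n}"] unfolding rb_tuples_def rb_scopes_def
  by (auto simp: PiE_iff)

abbreviation satisfies :: "(nat \<Rightarrow> nat) \<Rightarrow> nat set \<times> nat list set \<Rightarrow> bool" where
  "satisfies \<sigma> c \<equiv> map \<sigma> (sorted_list_of_set (fst c)) \<notin> snd c"

text \<open>Condition on the scope: whichever scope is drawn, \<sigma> induces one tuple, and a
  random relation avoids each tuple with the same probability.\<close>

lemma prob_satisfies:
  assumes "k \<le> n" "rb_q \<alpha> k p n < rb_d \<alpha> n ^ k" "\<sigma> \<in> {0..<n} \<rightarrow>\<^sub>E {0..<rb_d \<alpha> n}"
  shows "measure_pmf.prob (rb_constraint n \<alpha> k p) {c. satisfies \<sigma> c} =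
    (real (rb_d \<alpha> n ^ k) - real (rb_q \<alpha> k p n)) / real (rb_d \<alpha> n ^ k)" (is "_ = ?u")
proof -
  let ?P = "pmf_of_set (rb_scopes n k)"
  let ?B = "pmf_of_set {R. R \<subseteq> rb_tuples (rb_d \<alpha> n) k \<and> card R = rb_q \<alpha> k p n}"
  have set: "set_pmf ?P = rb_scopes n k" using rb_scopes_ne[OF assms(1)] finite_rb_scopes by simp
  have "measure_pmf.prob (rb_constraint n \<alpha> k p) {c. satisfies \<sigma> c} =
    measure_pmf.expectation ?P (\<lambda>S. measure_pmf.prob ?B {R. map \<sigma> (sorted_list_of_set S) \<notin> R})"
    unfolding rb_constraint_eq_pair_pmf measure_pair_pmf_eq_expectation by simp
  also have "\<dots> = measure_pmf.expectation ?P (\<lambda>S. ?u)"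
  proof (intro integral_cong_AE)
    show "AE S in ?P. measure_pmf.prob ?B {R. map \<sigma> (sorted_list_of_set S) \<notin> R} = ?u"
      unfolding AE_measure_pmf_iff set
      using measure_pmf_of_subsets_notin[OF finite_rb_tuples map_scope_in_rb_tuples[OF _ assms(3)]] assms(2)
      by (simp add: card_rb_tuples)
  qed auto
  finally show ?thesis by simp
qed

text \<open>Condition on the scope: the two induced tuples coincide exactly when the scope lies
  inside the agreement set, an event of probability \<open>c\<close>. Otherwise two distinct tuples
  have to be avoided.\<close>

lemma prob_satisfies_both:
  assumes "k \<le> n" "rb_q \<alpha> k p n < rb_d \<alpha> n ^ k"
    and \<sigma>: "\<sigma> \<in> {0..<n} \<rightarrow>\<^sub>E {0..<rb_d \<alpha> n}" and \<sigma>': "\<sigma>' \<in> {0..<n} \<rightarrow>\<^sub>E {0..<rb_d \<alpha> n}"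
  defines "N \<equiv> real (rb_d \<alpha> n ^ k)" and "q \<equiv> real (rb_q \<alpha> k p n)"
    and "c \<equiv> real (card {i \<in> {0..<n}. \<sigma> i = \<sigma>' i} choose k) / real (n choose k)"
  shows "measure_pmf.prob (rb_constraint n \<alpha> k p) {c. satisfies \<sigma> c \<and> satisfies \<sigma>' c} =
    c * ((N - q) / N) + (1 - c) * ((N - q) * (N - q - 1) / (N * (N - 1)))"
proof -
  let ?P = "pmf_of_set (rb_scopes n k)"
  let ?B = "pmf_of_set {R. R \<subseteq> rb_tuples (rb_d \<alpha> n) k \<and> card R = rb_q \<alpha> k p n}"
  let ?G = "{i \<in> {0..<n}. \<sigma> i = \<sigma>' i}"
  let ?u = "(N - q) / N" and ?v = "(N - q) * (N - q - 1) / (N * (N - 1))"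
  let ?x = "\<lambda>S. map \<sigma> (sorted_list_of_set S)" and ?y = "\<lambda>S. map \<sigma>' (sorted_list_of_set S)"
  have set: "set_pmf ?P = rb_scopes n k" using rb_scopes_ne[OF assms(1)] finite_rb_scopes by simp
  have "measure_pmf.prob (rb_constraint n \<alpha> k p) {c. satisfies \<sigma> c \<and> satisfies \<sigma>' c} =
    measure_pmf.expectation ?P (\<lambda>S. measure_pmf.prob ?B {R. ?x S \<notin> R \<and> ?y S \<notin> R})"
    unfolding rb_constraint_eq_pair_pmf measure_pair_pmf_eq_expectation by simp
  also have "\<dots> = measure_pmf.expectation ?P (\<lambda>S. ?v + (?u - ?v) * indicator {S. S \<subseteq> ?G} S)"
  proof (intro integral_cong_AE)
    show "AE S in ?P. measure_pmf.prob ?B {R. ?x S \<notin> R \<and> ?y S \<notin> R} =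
        ?v + (?u - ?v) * indicator {S. S \<subseteq> ?G} S"
      unfolding AE_measure_pmf_iff set
    proof
      fix S assume S: "S \<in> rb_scopes n k"
      then have S': "S \<subseteq> {0..<n}" "finite S" using finite_subset by (auto simp: rb_scopes_def)
      show "measure_pmf.prob ?B {R. ?x S \<notin> R \<and> ?y S \<notin> R} =
        ?v + (?u - ?v) * indicator {S. S \<subseteq> ?G} S"
      proof (cases "S \<subseteq> ?G")
        case True
        then have eq: "?y S = ?x S" using S' by auto
        show ?thesis unfolding eq using True measure_pmf_of_subsets_notin[OF finite_rb_tuples map_scope_in_rb_tuples[OF S \<sigma>]]
            assms(2) by (simp add: card_rb_tuples N_def q_def)
      next
        case False
        then have "?x S \<noteq> ?y S" using S' by auto
        then show ?thesis using False measure_pmf_of_subsets_notin_notin[OF finite_rb_tuples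
            map_scope_in_rb_tuples[OF S \<sigma>] map_scope_in_rb_tuples[OF S \<sigma>']] assms(2)
          by (simp add: card_rb_tuples N_def q_def)
      qed
    qed
  qed auto
  also have "\<dots> = ?v + (?u - ?v) * measure_pmf.prob ?P {S. S \<subseteq> ?G}"
  proof -
    have "integrable ?P (indicator {S. S \<subseteq> ?G} :: _ \<Rightarrow> real)"
      by (rule measure_pmf.integrable_const_bound[where B=1]) auto
    then show ?thesis by simp
  qed
  also have "measure_pmf.prob ?P {S. S \<subseteq> ?G} = c"
    using measure_pmf_of_subsets_subset[of "{0..<n}" ?G k] assms(1)
    by (simp add: rb_scopes_def c_def subset_iff)
  finally show ?thesis by (simp only: algebra_simps)
qed

section \<open>Independent constraints and agreement sets\<close>

lemma measure_Pi_pmf_const_lessThan: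
  "measure_pmf.prob (Pi_pmf {..<t::nat} dflt (\<lambda>_. P)) {C. \<forall>i<t. Q (C i)} = measure_pmf.prob P {c. Q c} ^ t"
proof -
  have "{C. \<forall>i<t. Q (C i)} = Pi {..<t} (\<lambda>_. {c. Q c})" by auto
  then show ?thesis by (simp add: measure_Pi_pmf_Pi)
qed

text \<open>The values of \<sigma>' on \<open>G\<close> are forced; at each point outside
  \<open>G\<close> one value is excluded.\<close>

lemma card_PiE_agreement:
  assumes "\<sigma> \<in> A \<rightarrow>\<^sub>E D" "finite A" "finite D" "G \<subseteq> A"
  shows "card {\<sigma>' \<in> A \<rightarrow>\<^sub>E D. {i \<in> A. \<sigma> i = \<sigma>' i} = G} = (card D - 1) ^ (card A - card G)"
proof -
  have "{\<sigma>' \<in> A \<rightarrow>\<^sub>E D. {i \<in> A. \<sigma> i = \<sigma>' i} = G} = (\<Pi>\<^sub>E i\<in>A. if i \<in> G then {\<sigma> i} else D - {\<sigma> i})"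
  proof (intro set_eqI iffI)
    fix \<sigma>' assume "\<sigma>' \<in> {\<sigma>' \<in> A \<rightarrow>\<^sub>E D. {i \<in> A. \<sigma> i = \<sigma>' i} = G}"
    then show "\<sigma>' \<in> (\<Pi>\<^sub>E i\<in>A. if i \<in> G then {\<sigma> i} else D - {\<sigma> i})" by (auto simp: PiE_iff)
  next
    fix \<sigma>' assume *: "\<sigma>' \<in> (\<Pi>\<^sub>E i\<in>A. if i \<in> G then {\<sigma> i} else D - {\<sigma> i})"
    have val: "\<sigma>' i \<in> (if i \<in> G then {\<sigma> i} else D - {\<sigma> i})" if "i \<in> A" for i
      using PiE_mem[OF * that] .
    have "\<sigma>' \<in> A \<rightarrow>\<^sub>E D"
    proof (rule PiE_I)
      fix i assume "i \<in> A"
      then show "\<sigma>' i \<in> D" using val[of i] PiE_mem[OF assms(1)] by (auto split: if_splits)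
    qed (use PiE_arb[OF *] in simp)
    moreover have "(i \<in> A \<and> \<sigma> i = \<sigma>' i) = (i \<in> G)" for i
      using val[of i] assms(4) by (auto split: if_splits)
    ultimately show "\<sigma>' \<in> {\<sigma>' \<in> A \<rightarrow>\<^sub>E D. {i \<in> A. \<sigma> i = \<sigma>' i} = G}" by auto
  qed
  then have "card {\<sigma>' \<in> A \<rightarrow>\<^sub>E D. {i \<in> A. \<sigma> i = \<sigma>' i} = G} =
      (\<Prod>i\<in>A. card (if i \<in> G then {\<sigma> i} else D - {\<sigma> i}))"
    using assms(2) by (simp add: card_PiE)
  also have "\<dots> = (\<Prod>i\<in>A. if i \<in> G then 1 else card D - 1)"
    using assms(1) by (intro prod.cong) (auto simp: PiE_iff)
  also have "\<dots> = (\<Prod>i\<in>A - G. card D - 1)"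
    using assms(2,4) by (simp add: prod.If_cases Int_absorb1 Diff_eq)
  finally show ?thesis using assms by (simp add: card_Diff_subset finite_subset)
qed

text \<open>Classify \<sigma>' by its agreement set, then by the size of that set. Up to a factor
  \<open>card D ^ card A\<close>, the weights are those of a binomial distribution with success
  probability \<open>1 / card D\<close>.\<close>

lemma sum_PiE_agreement:
  fixes g :: "nat \<Rightarrow> real"
  assumes "\<sigma> \<in> A \<rightarrow>\<^sub>E D" "finite A" "finite D"
  shows "(\<Sum>\<sigma>'\<in>A \<rightarrow>\<^sub>E D. g (card {i \<in> A. \<sigma> i = \<sigma>' i})) =
    (\<Sum>s\<le>card A. real (card A choose s) * real (card D - 1) ^ (card A - s) * g s)"
proof -
  let ?h = "\<lambda>s. real (card D - 1) ^ (card A - s) * g s"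
  have "(\<Sum>\<sigma>'\<in>A \<rightarrow>\<^sub>E D. g (card {i \<in> A. \<sigma> i = \<sigma>' i})) =
    (\<Sum>G\<in>Pow A. \<Sum>\<sigma>'\<in>{\<sigma>' \<in> A \<rightarrow>\<^sub>E D. {i \<in> A. \<sigma> i = \<sigma>' i} = G}. g (card {i \<in> A. \<sigma> i = \<sigma>' i}))"
    using assms by (intro sum.group[symmetric]) (auto intro: finite_PiE)
  also have "\<dots> = (\<Sum>G\<in>Pow A. ?h (card G))"
    using card_PiE_agreement[OF assms] by (intro sum.cong) auto
  also have "\<dots> = (\<Sum>s\<le>card A. \<Sum>G\<in>{G \<in> Pow A. card G = s}. ?h (card G))"
    using assms by (intro sum.group[symmetric]) (auto intro: card_mono)
  also have "\<dots> = (\<Sum>s\<le>card A. real (card A choose s) * ?h s)"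
    using n_subsets[OF assms(2)] by (intro sum.cong) auto
  finally show ?thesis by (simp add: mult.assoc)
qed

section \<open>First and second moment inequalities\<close>

text \<open>A natural number dominates the indicator of being positive. The bound \<open>B\<close>
  supplies integrability.\<close>

lemma prob_pos_le_expectation:
  fixes X :: "'a \<Rightarrow> nat"
  assumes "\<And>x. X x \<le> B"
  shows "measure_pmf.prob M {x. X x > 0} \<le> measure_pmf.expectation M (\<lambda>x. real (X x))"
proof -
  have "measure_pmf.expectation M (indicator {x. X x > 0} :: _ \<Rightarrow> real)
      \<le> measure_pmf.expectation M (\<lambda>x. real (X x))"
  proof (rule integral_mono)
    show "integrable M (indicator {x. X x > 0} :: _ \<Rightarrow> real)"
      by (rule measure_pmf.integrable_const_bound[where B=1]) auto
    show "integrable M (\<lambda>x. real (X x))"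
      using assms by (intro measure_pmf.integrable_const_bound[where B="real B"]) auto
  qed (auto simp: indicator_def)
  then show ?thesis by simp
qed

text \<open>With \<open>m\<close> the mean, this integrates the pointwise bound \<open>1 - (1 - X / m)\<^sup>2 \<le> 1\<^bsub>X > 0\<^esub>\<close>.\<close>

lemma prob_pos_ge_second_moment:
  fixes X :: "'a \<Rightarrow> nat"
  defines "m M \<equiv> measure_pmf.expectation M (\<lambda>x. real (X x))"
  assumes "\<And>x. X x \<le> B" and m: "m M > 0"
  shows "measure_pmf.prob M {x. X x > 0} \<ge>
    2 - measure_pmf.expectation M (\<lambda>x. (real (X x))\<^sup>2) / (m M)\<^sup>2"
proof -
  let ?f = "\<lambda>x. 2 / m M * real (X x) - 1 / (m M)\<^sup>2 * (real (X x))\<^sup>2"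
  have i1: "integrable M (\<lambda>x. real (X x))"
    using assms(2) by (intro measure_pmf.integrable_const_bound[where B="real B"]) auto
  have i2: "integrable M (\<lambda>x. (real (X x))\<^sup>2)"
    using assms(2) by (intro measure_pmf.integrable_const_bound[where B="(real B)\<^sup>2"])
      (auto intro!: power_mono)
  have "measure_pmf.expectation M ?f \<le> measure_pmf.expectation M (indicator {x. X x > 0} :: _ \<Rightarrow> real)"
  proof (rule integral_mono)
    show "integrable M (indicator {x. X x > 0} :: _ \<Rightarrow> real)"
      by (rule measure_pmf.integrable_const_bound[where B=1]) auto
    show "integrable M ?f" using i1 i2 by auto
    fix x
    have "?f x = 1 - (1 - real (X x) / m M)\<^sup>2" using m by (simp add: power2_eq_square field_simps)
    then show "?f x \<le> indicator {x. X x > 0} x" by (auto simp: indicator_def)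
  qed
  also have "measure_pmf.expectation M ?f =
      2 / m M * m M - 1 / (m M)\<^sup>2 * measure_pmf.expectation M (\<lambda>x. (real (X x))\<^sup>2)"
    using i1 i2 by (subst Bochner_Integration.integral_diff) (auto simp: m_def)
  finally show ?thesis using m by simp
qed

text \<open>Factors out the value for two independent events. The rest is centered: it vanishes at
  \<open>c = 1 / N\<close>, which is the mean of \<open>c\<close> over two random assignments when
  \<open>N = d ^ k\<close>.\<close>

lemma pair_correlation_eq:
  fixes N q c :: real
  assumes "N \<noteq> 0" "N \<noteq> 1" "N \<noteq> q"
  shows "c * ((N - q) / N) + (1 - c) * ((N - q) * (N - q - 1) / (N * (N - 1))) =
    ((N - q) / N)\<^sup>2 * (1 + q / (N - q) * ((N * c - 1) / (N - 1)))"
  using assms by (simp add: divide_simps power2_eq_square) algebra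

section \<open>The first two moments for Model RB\<close>

context
  fixes n k :: nat and \<alpha> r p :: real
  assumes kn: "k \<le> n" and qN: "rb_q \<alpha> k p n < rb_d \<alpha> n ^ k"
begin

private abbreviation "assignments \<equiv> {0..<n} \<rightarrow>\<^sub>E {0..<rb_d \<alpha> n}"
private abbreviation "N \<equiv> real (rb_d \<alpha> n ^ k)"
private abbreviation "q \<equiv> real (rb_q \<alpha> k p n)"
private abbreviation "d \<equiv> rb_d \<alpha> n"
private abbreviation "t \<equiv> rb_t \<alpha> r n"

private lemma num_solutions_eq_sum:
  "real (rb_num_solutions n \<alpha> r C) = (\<Sum>\<sigma>\<in>assignments. indicator {C. rb_is_solution t C \<sigma>} C)"
  unfolding rb_num_solutions_def
  by (simp add: indicator_def finite_PiE Int_def flip: sum.inter_filter)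

private lemma num_solutions_le: "rb_num_solutions n \<alpha> r C \<le> card assignments"
  unfolding rb_num_solutions_def by (intro card_mono finite_PiE) auto

private lemma integrable_indicator_pmf: "integrable (measure_pmf M) (indicator A :: _ \<Rightarrow> real)"
  by (rule measure_pmf.integrable_const_bound[where B=1]) auto

private lemma card_assignments: "card assignments = d ^ n"
  by (simp add: card_PiE)

private lemma prob_is_solution:
  assumes "\<sigma> \<in> assignments"
  shows "measure_pmf.prob (rb_instance n \<alpha> r k p) {C. rb_is_solution t C \<sigma>} = ((N - q) / N) ^ t"
  using prob_satisfies[OF kn qN assms]
    measure_Pi_pmf_const_lessThan[of t "({}, {})" "rb_constraint n \<alpha> k p" "satisfies \<sigma>"]
  unfolding rb_instance_def rb_is_solution_def by simp

lemma expectation_rb_num_solutions: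
  "measure_pmf.expectation (rb_instance n \<alpha> r k p) (\<lambda>C. real (rb_num_solutions n \<alpha> r C)) =
    real d ^ n * ((N - q) / N) ^ t"
  unfolding num_solutions_eq_sum
  by (subst Bochner_Integration.integral_sum)
    (auto simp: integrable_indicator_pmf prob_is_solution card_assignments)

text \<open>Expand the square over pairs of assignments. By independence of the constraints, a pair
  contributes a \<open>t\<close>-th power depending only on the size of its agreement set, so the
  inner sum is the same for every first assignment.\<close>

lemma expectation_rb_num_solutions_squared:
  "measure_pmf.expectation (rb_instance n \<alpha> r k p) (\<lambda>C. (real (rb_num_solutions n \<alpha> r C))\<^sup>2) =
    real d ^ n * (\<Sum>s\<le>n. real (n choose s) * real (d - 1) ^ (n - s) *
      (real (s choose k) / real (n choose k) * ((N - q) / N) +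
       (1 - real (s choose k) / real (n choose k)) * ((N - q) * (N - q - 1) / (N * (N - 1)))) ^ t)"
    (is "_ = _ * (\<Sum>s\<le>n. _ * _ * ?h s ^ t)")
proof -
  let ?M = "rb_instance n \<alpha> r k p"
  let ?agree = "\<lambda>\<sigma> \<sigma>'. card {i \<in> {0..<n}. \<sigma> i = \<sigma>' i}"
  have "(\<lambda>C. (real (rb_num_solutions n \<alpha> r C))\<^sup>2) = (\<lambda>C. \<Sum>\<sigma>\<in>assignments. \<Sum>\<sigma>'\<in>assignments.
      indicator {C. rb_is_solution t C \<sigma> \<and> rb_is_solution t C \<sigma>'} C)"
    unfolding num_solutions_eq_sum power2_eq_square sum_product
    by (intro ext sum.cong refl) (auto simp: indicator_def)
  then have "measure_pmf.expectation ?M (\<lambda>C. (real (rb_num_solutions n \<alpha> r C))\<^sup>2) =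
      (\<Sum>\<sigma>\<in>assignments. \<Sum>\<sigma>'\<in>assignments.
        measure_pmf.prob ?M {C. rb_is_solution t C \<sigma> \<and> rb_is_solution t C \<sigma>'})"
    by (simp add: Bochner_Integration.integral_sum integrable_indicator_pmf)
  also have "\<dots> = (\<Sum>\<sigma>\<in>assignments. \<Sum>\<sigma>'\<in>assignments. ?h (?agree \<sigma> \<sigma>') ^ t)"
  proof (intro sum.cong refl)
    fix \<sigma> \<sigma>' assume *: "\<sigma> \<in> assignments" "\<sigma>' \<in> assignments"
    have "{C. rb_is_solution t C \<sigma> \<and> rb_is_solution t C \<sigma>'} =
        {C. \<forall>i<t. satisfies \<sigma> (C i) \<and> satisfies \<sigma>' (C i)}"
      by (auto simp: rb_is_solution_def)
    then show "measure_pmf.prob ?M {C. rb_is_solution t C \<sigma> \<and> rb_is_solution t C \<sigma>'} =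
        ?h (?agree \<sigma> \<sigma>') ^ t"
      unfolding rb_instance_def
      using measure_Pi_pmf_const_lessThan[of t "({}, {})" "rb_constraint n \<alpha> k p"
          "\<lambda>c. satisfies \<sigma> c \<and> satisfies \<sigma>' c"] prob_satisfies_both[OF kn qN *]
      by simp
  qed
  also have "\<dots> = (\<Sum>\<sigma>\<in>assignments. \<Sum>s\<le>n. real (n choose s) * real (d - 1) ^ (n - s) * ?h s ^ t)"
    using sum_PiE_agreement[of _ "{0..<n}" "{0..<d}" "\<lambda>s. ?h s ^ t"] by (intro sum.cong refl) simp
  finally show ?thesis by (simp add: card_assignments)
qed

lemma rb_prob_sat_le: "rb_prob_sat n \<alpha> r k p \<le> real d ^ n * ((N - q) / N) ^ t"
  unfolding rb_prob_sat_def expectation_rb_num_solutions[symmetric]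
  by (rule prob_pos_le_expectation[OF num_solutions_le])

text \<open>Dividing the second moment by the squared mean cancels \<open>(?u ^ t)\<^sup>2\<close>
  and turns the counts into binomial weights, so the quotient is the average of
  \<open>?Y s ^ t\<close> over a binomial overlap \<open>s\<close>.\<close>

lemma rb_prob_sat_ge:
  assumes d: "d \<ge> 2" and k: "k \<ge> 1"
  shows "rb_prob_sat n \<alpha> r k p \<ge> 2 -
    (\<Sum>s\<le>n. real (n choose s) * (1 / real d) ^ s * (1 - 1 / real d) ^ (n - s) *
      (1 + q / (N - q) * ((N * (real (s choose k) / real (n choose k)) - 1) / (N - 1))) ^ t)"
proof -
  let ?c = "\<lambda>s. real (s choose k) / real (n choose k)"
  let ?u = "(N - q) / N" and ?v = "(N - q) * (N - q - 1) / (N * (N - 1))"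
  let ?Y = "\<lambda>s. 1 + q / (N - q) * ((N * ?c s - 1) / (N - 1))"
  have Nq: "N - q > 0" using qN by linarith
  have "2 ^ 1 \<le> d ^ k" using d k by (metis order_trans power_increasing power_mono one_le_numeral zero_le)
  then have N2: "N \<ge> 2" by (metis of_nat_le_iff of_nat_numeral power_one_right)
  have h: "?c s * ?u + (1 - ?c s) * ?v = ?u\<^sup>2 * ?Y s" for s
  proof -
    show ?thesis using Nq N2 by (intro pair_correlation_eq) linarith+
  qed
  have m: "real d ^ n * ?u ^ t > 0" using d Nq N2 by simp
  have "(real d ^ n * (\<Sum>s\<le>n. real (n choose s) * real (d - 1) ^ (n - s) * (?u\<^sup>2 * ?Y s) ^ t)) /
      (real d ^ n * ?u ^ t)\<^sup>2 =
      (\<Sum>s\<le>n. real (n choose s) * (real (d - 1) ^ (n - s) / real d ^ n) * ?Y s ^ t)"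
  proof -
    have cancel: "D * (b * (w\<^sup>2 * y)) / (D * w)\<^sup>2 = b / D * y" if "D * w > 0" for D b w y :: real
      using that by (auto simp: power2_eq_square divide_simps)
    have "(?u\<^sup>2 * ?Y s) ^ t = (?u ^ t)\<^sup>2 * ?Y s ^ t" for s
      by (simp only: power_mult_distrib power_commutes flip: power_mult) (simp add: mult.commute)
    then show ?thesis using cancel[OF m] by (simp add: sum_distrib_left sum_divide_distrib del: of_nat_power)
  qed
  also have "\<dots> = (\<Sum>s\<le>n. real (n choose s) * (1 / real d) ^ s * (1 - 1 / real d) ^ (n - s) * ?Y s ^ t)"
  proof (intro sum.cong refl)
    fix s assume "s \<in> {..n}"
    then have "real d ^ n = real d ^ s * real d ^ (n - s)" by (simp flip: power_add)
    moreover have "1 - 1 / real d = real (d - 1) / real d" using d by (simp add: of_nat_diff field_simps)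
    ultimately have "real (d - 1) ^ (n - s) / real d ^ n = (1 / real d) ^ s * (1 - 1 / real d) ^ (n - s)"
      by (simp add: power_divide)
    then show "real (n choose s) * (real (d - 1) ^ (n - s) / real d ^ n) * ?Y s ^ t =
        real (n choose s) * (1 / real d) ^ s * (1 - 1 / real d) ^ (n - s) * ?Y s ^ t" by simp
  qed
  finally show ?thesis
    using prob_pos_ge_second_moment[of "rb_num_solutions n \<alpha> r" "card assignments" "rb_instance n \<alpha> r k p"]
      num_solutions_le m
    unfolding rb_prob_sat_def expectation_rb_num_solutions expectation_rb_num_solutions_squared h
    by auto
qed

end

subsection \<open>The exponent of large overlaps\<close>

text \<open>The derivative of \<open>r * ln (1 + b * x ^ k) - x\<close> has the sign of
  \<open>m x = r * k * b * x ^ (k - 1) - 1 - b * x ^ k\<close>, and \<open>m\<close> changes sign at most once on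
  \<open>[0, 1]\<close>, from negative to nonnegative. The lower bound on \<open>k\<close> says \<open>m 1 \<ge> 0\<close>.\<close>

lemma ln_one_plus_power_le:
  fixes r x :: real
  assumes r: "r > 0" and k: "k \<ge> 2" and x: "0 \<le> x" "x \<le> 1"
    and kr: "real k \<ge> exp (1 / r) * ln (exp (1 / r)) / (exp (1 / r) - 1)"
  shows "r * ln (1 + (exp (1 / r) - 1) * x ^ k) \<le> x"
proof -
  define b where "b = exp (1 / r) - 1"
  obtain j where j: "k = Suc (Suc j)" using k by (metis add_2_eq_Suc le_Suc_ex)
  have b: "b > 0" using r by (simp add: b_def)
  define m where "m = (\<lambda>x. r * real k * b * x ^ Suc j - 1 - b * x ^ k)"
  define g where "g = (\<lambda>x. r * ln (1 + b * x ^ k) - x)"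
  have pos: "1 + b * y ^ k > 0" if "y \<ge> 0" for y
    using b that by (simp add: add_pos_nonneg)
  have m1: "m 1 \<ge> 0"
  proof -
    have "real k \<ge> (1 + b) * (1 / r) / b" using kr by (simp add: b_def)
    then have "real k * b \<ge> (1 + b) * (1 / r)" using pos_divide_le_eq[OF b] by blast
    then have "real k * b * r \<ge> (1 + b)" using r by (simp add: pos_divide_le_eq)
    then show ?thesis by (simp add: m_def mult_ac)
  qed
  \<comment> \<open>On nonnegative \<open>y\<close> the derivative changes sign at
    \<open>r * (k - 1)\<close>: \<open>m\<close> rises and then falls.\<close>
  have dm: "(m has_real_derivative b * real k * y ^ j * (r * real (Suc j) - y)) (at y)" for y
  proof -
    have "(m has_real_derivative r * real k * b * (real (Suc j) * y ^ (Suc j - Suc 0)) - 0 -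
        b * (real k * y ^ (k - Suc 0))) (at y)"
      unfolding m_def by (intro DERIV_diff DERIV_cmult DERIV_pow DERIV_const)
    then show ?thesis by (simp add: j algebra_simps)
  qed
  \<comment> \<open>Before the peak, \<open>m z\<close> is at least \<open>m y\<close>; after it, at
    least \<open>m 1\<close>.\<close>
  have m_mono: "m z \<ge> 0" if "m y \<ge> 0" "0 \<le> y" "y \<le> z" "z \<le> 1" for y z
  proof (cases "z \<le> r * real (Suc j)")
    case True
    have "m y \<le> m z"
    proof (rule DERIV_nonneg_imp_nondecreasing[OF that(3)])
      fix w assume w: "y \<le> w" "w \<le> z"
      show "\<exists>l. (m has_real_derivative l) (at w) \<and> 0 \<le> l"
        by (rule exI, rule conjI, rule dm) (use w True b that(2) in auto)
    qed
    then show ?thesis using that by simp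
  next
    case False
    have "m 1 \<le> m z"
    proof (rule DERIV_nonpos_imp_nonincreasing[OF that(4)])
      fix w assume w: "z \<le> w" "w \<le> 1"
      show "\<exists>l. (m has_real_derivative l) (at w) \<and> l \<le> 0"
        by (rule exI, rule conjI, rule dm) (use w False b that(2,3) in \<open>auto intro!: mult_nonneg_nonpos\<close>)
    qed
    then show ?thesis using m1 by simp
  qed
  have dg: "(g has_real_derivative m y / (1 + b * y ^ k)) (at y)" if "y \<ge> 0" for y
  proof -
    have "((\<lambda>y. 1 + b * y ^ k) has_real_derivative 0 + b * (real k * y ^ (k - Suc 0))) (at y)"
      by (intro DERIV_add DERIV_const DERIV_cmult DERIV_pow)
    then have "(g has_real_derivative
        r * (1 / (1 + b * y ^ k) * (0 + b * (real k * y ^ (k - Suc 0)))) - 1) (at y)"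
      unfolding g_def
      by (intro DERIV_diff DERIV_cmult DERIV_ident DERIV_chain2[where f=ln] DERIV_ln_divide pos[OF that])
    also have "r * (1 / (1 + b * y ^ k) * (0 + b * (real k * y ^ (k - Suc 0)))) - 1 = m y / (1 + b * y ^ k)"
    proof -
      have "m y = r * (b * (real k * y ^ (k - Suc 0))) - (1 + b * y ^ k)" by (simp add: m_def j)
      then show ?thesis using pos[OF that] by (simp add: diff_divide_distrib)
    qed
    finally show ?thesis .
  qed
  \<comment> \<open>If \<open>m x\<close> is nonnegative, \<open>g\<close> increases from
    \<open>x\<close> to 1; otherwise \<open>g\<close> decreases from 0 to \<open>x\<close>. At both
    ends \<open>g\<close> is 0, at 1 by the value of \<open>b\<close>.\<close>
  have "g x \<le> 0"
  proof (cases "m x \<ge> 0")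
    case True
    have "g x \<le> g 1"
    proof (rule DERIV_nonneg_imp_nondecreasing[OF x(2)])
      fix w assume w: "x \<le> w" "w \<le> 1"
      show "\<exists>l. (g has_real_derivative l) (at w) \<and> 0 \<le> l"
        by (rule exI, rule conjI, rule dg) (use w m_mono[OF True x(1), of w] pos[of w] x in auto)
    qed
    also have "g 1 = 0" using r by (simp add: g_def b_def)
    finally show ?thesis .
  next
    case False
    have "g x \<le> g 0"
    proof (rule DERIV_nonpos_imp_nonincreasing[OF x(1)])
      fix w assume w: "0 \<le> w" "w \<le> x"
      have "m w \<le> 0" using m_mono[of w x] w x False by linarith
      show "\<exists>l. (g has_real_derivative l) (at w) \<and> l \<le> 0"
        by (rule exI, rule conjI, rule dg) (use w pos[of w] \<open>m w \<le> 0\<close> in \<open>auto intro!: divide_nonpos_pos\<close>)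
    qed
    also have "g 0 = 0" using j by (simp add: g_def)
    finally show ?thesis .
  qed
  then show ?thesis by (simp add: g_def b_def)
qed

text \<open>Since \<open>k\<close> is at least 2, the left side is quadratically small near 0, where
  it has to beat a linear term.\<close>

lemma ln_one_plus_power_le_square:
  fixes r a x :: real
  assumes "r > 0" "a > 0" "k \<ge> 2" "0 \<le> x" "x \<le> 1"
  shows "r * ln (1 + a * x ^ k) \<le> r * a * x * x"
proof -
  have "ln (1 + a * x ^ k) \<le> a * x ^ k" using assms by (intro ln_add_one_self_le_self) auto
  also have "\<dots> \<le> a * x ^ 2" using assms by (intro mult_left_mono power_decreasing) auto
  finally show ?thesis using assms by (simp add: power2_eq_square mult_left_mono mult.assoc)
qed

text \<open>For \<open>a\<close> strictly below \<open>exp (1 / r) - 1\<close>, the bound of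
  \<open>ln_one_plus_power_le\<close> becomes strict on \<open>(0, 1]\<close>. Compactness makes it
  uniform on \<open>[\<epsilon>, 1]\<close>, and the quadratic bound handles \<open>x\<close> below
  \<epsilon>.\<close>

lemma ln_one_plus_power_uniform:
  fixes r a :: real
  assumes r: "r > 0" and k: "k \<ge> 2" and a: "0 < a" "a < exp (1 / r) - 1"
    and kr: "real k \<ge> exp (1 / r) * ln (exp (1 / r)) / (exp (1 / r) - 1)"
  obtains \<delta> where "\<delta> > 0" "\<And>x. 0 \<le> x \<Longrightarrow> x \<le> 1 \<Longrightarrow> r * ln (1 + a * x ^ k) \<le> (1 - \<delta>) * x"
proof -
  define f where "f = (\<lambda>x. r * ln (1 + a * x ^ k) / x)"
  \<comment> \<open>Makes \<open>r * a * \<epsilon>\<close> at most 1/2; the cap at 1 keeps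
    \<open>[\<epsilon>, 1]\<close> nonempty.\<close>
  define \<epsilon> where "\<epsilon> = min 1 (1 / (2 * r * a))"
  have \<epsilon>: "0 < \<epsilon>" "\<epsilon> \<le> 1" "\<epsilon> * (2 * r * a) \<le> 1"
    using r a by (auto simp: \<epsilon>_def min_def field_simps)
  have pos: "1 + a * x ^ k > 0" if "x \<ge> 0" for x
    using a that by (simp add: add_pos_nonneg)
  have "continuous_on {\<epsilon>..1} f"
    unfolding f_def using \<epsilon> pos by (intro continuous_intros) (auto simp: less_imp_neq[symmetric])
  then obtain x0 where x0: "x0 \<in> {\<epsilon>..1}" "\<And>x. x \<in> {\<epsilon>..1} \<Longrightarrow> f x \<le> f x0"
    using continuous_attains_sup[of "{\<epsilon>..1}" f] \<epsilon> by auto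
  have "r * ln (1 + a * x0 ^ k) < r * ln (1 + (exp (1 / r) - 1) * x0 ^ k)"
  proof -
    have "a * x0 ^ k < (exp (1 / r) - 1) * x0 ^ k"
      using x0(1) \<epsilon>(1) a by (intro mult_strict_right_mono) auto
    moreover have "1 + a * x0 ^ k > 0" using pos[of x0] x0(1) \<epsilon>(1) by simp
    ultimately have "ln (1 + a * x0 ^ k) < ln (1 + (exp (1 / r) - 1) * x0 ^ k)"
      by (subst ln_less_cancel_iff) linarith+
    then show ?thesis using r by (rule mult_strict_left_mono)
  qed
  also have "\<dots> \<le> x0" using ln_one_plus_power_le[OF r k _ _ kr] x0(1) \<epsilon>(1) by simp
  finally have f1: "f x0 < 1" using x0(1) \<epsilon>(1) by (simp add: f_def)
  show ?thesis
  \<comment> \<open>The slack is 1/2 below \<epsilon> and \<open>1 - f x0\<close> above it.\<close>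
  proof (rule that[of "min (1/2) (1 - f x0)"])
    show "min (1/2) (1 - f x0) > 0" using f1 by simp
    fix x :: real assume x: "0 \<le> x" "x \<le> 1"
    show "r * ln (1 + a * x ^ k) \<le> (1 - min (1/2) (1 - f x0)) * x"
    proof (cases "x < \<epsilon>")
      case True
      have "r * ln (1 + a * x ^ k) \<le> r * a * x * x" by (rule ln_one_plus_power_le_square) (use assms x in auto)
      also have "\<dots> \<le> r * a * \<epsilon> * x" using True x r a by (intro mult_right_mono mult_left_mono) auto
      also have "\<dots> \<le> 1/2 * x" using \<epsilon>(3) x by (intro mult_right_mono) (auto simp: mult_ac)
      also have "\<dots> \<le> (1 - min (1/2) (1 - f x0)) * x" using x by (intro mult_right_mono) (auto simp: min_def)
      finally show ?thesis .
    next
      case False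
      then have "f x \<le> 1 - min (1/2) (1 - f x0)" using x0(2)[of x] x by auto
      then show ?thesis using False \<epsilon>(1) by (simp add: f_def pos_divide_le_eq)
    qed
  qed
qed

text \<open>For overlap \<open>n * x\<close>, the first summand bounds the exponent per variable of
  the binomial weight, the second that of the correlation factor. For \<open>x\<close> up to a
  constant \<epsilon>, the lower bound on \<open>x\<close> leaves a gain of
  \<open>\<eta> * ln D\<close> in the first, of which the second uses at most half. For larger
  \<open>x\<close>, \<open>- ln x\<close> is bounded and the slack \<delta> of the hypothesis
  remains.\<close>

lemma large_overlap_exponent:
  fixes r a \<eta> \<delta> :: real
  assumes r: "r > 0" and k: "k \<ge> 2" and a: "0 < a" and \<eta>: "0 < \<eta>" "\<eta> < 1" and \<delta>: "\<delta> > 0"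
    and *: "\<And>x. 0 \<le> x \<Longrightarrow> x \<le> 1 \<Longrightarrow> r * ln (1 + a * x ^ k) \<le> (1 - \<delta>) * x"
  obtains C \<delta>' where "\<delta>' > 0"
    "\<And>D x. D \<ge> 1 \<Longrightarrow> D powr (\<eta> - 1) \<le> x \<Longrightarrow> x \<le> 1 \<Longrightarrow>
      x * (1 - ln x - ln D) + ln D * (r * ln (1 + a * x ^ k)) \<le> x * (C - \<delta>' * ln D)"
proof -
  \<comment> \<open>Makes \<open>r * a * \<epsilon>\<close> equal to
    \<open>\<eta> / 2\<close>.\<close>
  define \<epsilon> where "\<epsilon> = \<eta> / (2 * r * a)"
  have \<epsilon>: "\<epsilon> > 0" using assms by (simp add: \<epsilon>_def)
  show ?thesis
  proof (rule that[of "min \<delta> (\<eta> / 2)" "1 + \<bar>ln \<epsilon>\<bar>"])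
    show "min \<delta> (\<eta> / 2) > 0" using \<delta> \<eta> by simp
    fix D x :: real assume D: "D \<ge> 1" and x1: "D powr (\<eta> - 1) \<le> x" and x2: "x \<le> 1"
    have x0: "x > 0" using D x1 by (smt (verit) powr_gt_zero)
    have L: "ln D \<ge> 0" using D by simp
    show "x * (1 - ln x - ln D) + ln D * (r * ln (1 + a * x ^ k))
        \<le> x * (1 + \<bar>ln \<epsilon>\<bar> - min \<delta> (\<eta> / 2) * ln D)"
    proof (cases "x \<le> \<epsilon>")
      case True
      have "r * ln (1 + a * x ^ k) \<le> r * a * x * x" by (rule ln_one_plus_power_le_square) (use assms x0 x2 in auto)
      also have "\<dots> \<le> r * a * x * \<epsilon>" using True x0 r a by (intro mult_left_mono) auto
      also have "\<dots> = x * (\<eta> / 2)" using r a by (simp add: \<epsilon>_def)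
      finally have 1: "ln D * (r * ln (1 + a * x ^ k)) \<le> ln D * (x * (\<eta> / 2))"
        using L by (rule mult_left_mono)
      have "ln (D powr (\<eta> - 1)) \<le> ln x" using x1 D x0 by (intro ln_mono) auto
      then have 2: "- ln x \<le> (1 - \<eta>) * ln D" using D by (simp add: ln_powr algebra_simps)
      have 3: "min \<delta> (\<eta> / 2) * ln D \<le> \<eta> / 2 * ln D" using L by (intro mult_right_mono) auto
      have "1 - ln x - ln D + ln D * (\<eta> / 2) \<le> 1 + \<bar>ln \<epsilon>\<bar> - min \<delta> (\<eta> / 2) * ln D"
        using 2 3 by (simp add: algebra_simps)
      then have "x * (1 - ln x - ln D + ln D * (\<eta> / 2)) \<le> x * (1 + \<bar>ln \<epsilon>\<bar> - min \<delta> (\<eta> / 2) * ln D)"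
        using x0 by (intro mult_left_mono) auto
      then show ?thesis using 1 by (simp add: algebra_simps)
    next
      case False
      have 1: "ln D * (r * ln (1 + a * x ^ k)) \<le> ln D * ((1 - \<delta>) * x)"
        using L x0 x2 by (intro mult_left_mono *) auto
      have "ln \<epsilon> \<le> ln x" using False \<epsilon> by simp
      then have 2: "- ln x \<le> \<bar>ln \<epsilon>\<bar>" by linarith
      have 3: "min \<delta> (\<eta> / 2) * ln D \<le> \<delta> * ln D" using L by (intro mult_right_mono) auto
      have "1 - ln x - ln D + ln D * (1 - \<delta>) \<le> 1 + \<bar>ln \<epsilon>\<bar> - min \<delta> (\<eta> / 2) * ln D"
        using 2 3 by (simp add: algebra_simps)
      then have "x * (1 - ln x - ln D + ln D * (1 - \<delta>)) \<le> x * (1 + \<bar>ln \<epsilon>\<bar> - min \<delta> (\<eta> / 2) * ln D)"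
        using x0 by (intro mult_left_mono) auto
      then show ?thesis using 1 by (simp add: algebra_simps)
    qed
  qed
qed

section \<open>Binomial coefficients and differences of powers\<close>

text \<open>For \<open>k \<le> s\<close> the quotient is a product of factors
  \<open>(s - i) / (n - i)\<close>, each at most \<open>s / n\<close>. The induction uses the form
  without division.\<close>

lemma choose_quotient_le_power:
  assumes "s \<le> n" "k \<le> n"
  shows "real (s choose k) / real (n choose k) \<le> (real s / real n) ^ k"
proof -
  have "real (s choose k) * real n ^ k \<le> real s ^ k * real (n choose k)"
  proof (induction k)
    case (Suc k)
    show ?case
    proof (cases "k < s")
      case True
      have absorb: "real (Suc k) * real (m choose Suc k) = (real m - real k) * real (m choose k)"
        if "k < m" for m
        using binomial_absorb_comp[of m k] binomial_absorption[of k "m"] that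
        by (metis Suc_times_binomial_eq binomial_absorption of_nat_diff of_nat_mult less_imp_le mult.commute)
      have "real (Suc k) * (real (s choose Suc k) * real n ^ Suc k) =
          ((real s - real k) * real n) * (real (s choose k) * real n ^ k)"
        using arg_cong[OF absorb[OF True], of "\<lambda>z. z * (real n * real n ^ k)"]
        by (simp only: power_Suc mult_ac)
      also have "\<dots> \<le> (real s * (real n - real k)) * (real s ^ k * real (n choose k))"
      proof (rule mult_mono[OF _ Suc])
        have "real k * real s \<le> real k * real n" using assms(1) by (intro mult_left_mono) auto
        then show "(real s - real k) * real n \<le> real s * (real n - real k)" by (simp add: algebra_simps)
      qed (use True assms(1) in auto)
      also have "\<dots> = real (Suc k) * (real s ^ Suc k * real (n choose Suc k))"
        using arg_cong[OF absorb[of n], of "\<lambda>z. z * (real s * real s ^ k)"] True assms(1)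
        by (simp only: power_Suc mult_ac)
      finally show ?thesis by (simp add: mult_le_cancel_left)
    qed (simp add: binomial_eq_0)
  qed simp
  moreover have "real (n choose k) > 0" using assms(2) by simp
  ultimately show ?thesis by (cases "n = 0") (use assms in \<open>auto simp: power_divide field_simps\<close>)
qed

text \<open>Combines \<open>n ^ s / fact s\<close> as a bound for the coefficient with
  \<open>s ^ s / fact s \<le> exp s\<close>, a single term of the exponential series.\<close>

lemma binomial_le_exp_power:
  assumes "s \<ge> 1"
  shows "real (n choose s) \<le> (exp 1 * real n / real s) ^ s"
proof -
  have "real s ^ s / fact s \<le> exp (real s)"
  proof -
    have "(\<lambda>n. inverse (fact n) * real s ^ n) sums exp (real s)"
      using exp_converges[of "real s"] by (simp add: real_scaleR_def)
    from sum_le_suminf[OF sums_summable[OF this], of "{s}"] sums_unique[OF this]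
    show ?thesis by (simp add: divide_inverse mult.commute)
  qed
  then have 1: "real s ^ s \<le> exp 1 ^ s * fact s"
    by (simp add: pos_divide_le_eq flip: exp_of_nat_mult)
  have 2: "real (n choose s) * fact s \<le> real n ^ s"
    using binomial_fact_pow[of n s] by (metis of_nat_fact of_nat_le_iff of_nat_mult of_nat_power)
  have "real (n choose s) * real s ^ s \<le> real (n choose s) * (exp 1 ^ s * fact s)"
    using 1 by (rule mult_left_mono) simp
  also have "\<dots> \<le> exp 1 ^ s * real n ^ s" using 2 by (simp add: mult_left_mono mult_ac)
  finally show ?thesis using assms by (simp add: power_divide power_mult_distrib pos_le_divide_eq)
qed

text \<open>The difference is \<open>x - y\<close> times a sum of \<open>k\<close> monomials of
  degree \<open>k - 1\<close>, each at most \<open>z ^ (k - 1)\<close>.\<close>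

lemma power_diff_le_mult:
  fixes x y z :: real
  assumes "0 \<le> y" "y \<le> x" "x \<le> z"
  shows "x ^ k - y ^ k \<le> real k * z ^ (k - 1) * (x - y)"
proof -
  have "(\<Sum>i<k. y ^ (k - Suc i) * x ^ i) \<le> (\<Sum>i<k. z ^ (k - 1))"
  proof (rule sum_mono)
    fix i assume "i \<in> {..<k}"
    then have "z ^ (k - 1) = z ^ (k - Suc i) * z ^ i" by (simp flip: power_add)
    then show "y ^ (k - Suc i) * x ^ i \<le> z ^ (k - 1)"
      using assms by (auto intro!: mult_mono power_mono)
  qed
  then have "(x - y) * (\<Sum>i<k. y ^ (k - Suc i) * x ^ i) \<le> (x - y) * (real k * z ^ (k - 1))"
    using assms by (intro mult_left_mono) auto
  then show ?thesis using power_diff_sumr2[of x k y] by (simp add: mult_ac)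
qed

subsection \<open>Averaging over the overlap\<close>

text \<open>The binomial theorem with \<open>exp \<theta>\<close> absorbed into the powers of
  \<open>p\<close>; \<open>\<theta> = 0\<close> gives total mass 1.\<close>

lemma binomial_exp_moment:
  fixes p \<theta> :: real
  shows "(\<Sum>s\<le>n. real (n choose s) * p ^ s * (1 - p) ^ (n - s) * exp (\<theta> * real s)) =
    (p * exp \<theta> + (1 - p)) ^ n"
  unfolding binomial_ring
  by (intro sum.cong refl) (simp add: power_mult_distrib mult_ac flip: exp_of_nat_mult)

text \<open>Since \<open>e\<^bsup>max 0 z\<^esup> \<le> 1 + \<bar>e\<^bsup>z\<^esup> - 1\<bar>\<close> and \<open>E e\<^bsup>z\<^esup> \<ge> 1\<close> for centered \<open>z\<close>, Cauchy--Schwarz bounds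
  the positive part by \<open>1 + sqrt (E e\<^bsup>2z\<^esup> - 1)\<close>.\<close>

lemma binomial_exp_upper_deviation:
  fixes p l :: real
  assumes p: "0 \<le> p" "p \<le> 1" and l: "0 \<le> l" "l \<le> 1/2"
  shows "(\<Sum>s\<le>n. real (n choose s) * p ^ s * (1 - p) ^ (n - s) * exp (l * max 0 (real s - real n * p)))
    \<le> 1 + sqrt (exp (4 * l\<^sup>2 * (real n * p)) - 1)"
proof -
  define b where "b = (\<lambda>s. real (n choose s) * p ^ s * (1 - p) ^ (n - s))"
  define \<mu> where "\<mu> = real n * p"
  define w where "w = (\<lambda>s::nat. exp (l * (real s - \<mu>)))"
  have b0: "b s \<ge> 0" for s using p by (simp add: b_def)
  have b1: "(\<Sum>s\<le>n. b s) = 1" using binomial_exp_moment[of n p 0] by (simp add: b_def)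
  have mom: "(\<Sum>s\<le>n. b s * exp (\<theta> * (real s - \<mu>))) = (p * exp \<theta> + (1 - p)) ^ n * exp (- (\<theta> * \<mu>))" for \<theta>
    unfolding binomial_exp_moment[symmetric] sum_distrib_right b_def
    by (intro sum.cong refl) (simp add: right_diff_distrib exp_diff exp_minus field_simps)
  \<comment> \<open>Jensen's inequality for a single Bernoulli trial, raised to the power
    \<open>n\<close>.\<close>
  have lower: "(\<Sum>s\<le>n. b s * w s) \<ge> 1"
  proof -
    have "exp (p * l) \<le> p * exp l + (1 - p)"
      using convex_onD[OF exp_convex, of p 0 l] p by simp
    then have "exp (p * l) ^ n \<le> (p * exp l + (1 - p)) ^ n" by (rule power_mono) simp
    moreover have "exp (p * l) ^ n = exp (l * \<mu>)"
      by (simp add: \<mu>_def mult_ac flip: exp_of_nat_mult)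
    ultimately show ?thesis unfolding w_def mom
      by (simp add: exp_minus field_simps)
  qed
  \<comment> \<open>After \<open>1 + y \<le> exp y\<close>, the quadratic bound for
    \<open>exp (2 * l)\<close> applies because \<open>2 * l\<close> is at most 1; the centering
    removes the linear term.\<close>
  have upper: "(\<Sum>s\<le>n. b s * (w s)\<^sup>2) \<le> exp (4 * l\<^sup>2 * \<mu>)"
  proof -
    have "p * exp (2 * l) + (1 - p) = 1 + p * (exp (2 * l) - 1)" by (simp add: algebra_simps)
    also have "\<dots> \<le> exp (p * (exp (2 * l) - 1))" by (rule exp_ge_add_one_self)
    finally have "(p * exp (2 * l) + (1 - p)) ^ n \<le> exp (p * (exp (2 * l) - 1)) ^ n"
      using p by (intro power_mono) auto
    also have "\<dots> = exp (\<mu> * (exp (2 * l) - 1))" by (simp add: \<mu>_def mult_ac flip: exp_of_nat_mult)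
    also have "\<dots> \<le> exp (\<mu> * (2 * l + (2 * l)\<^sup>2))"
      using exp_bound[of "2 * l"] l p by (auto simp: \<mu>_def intro!: mult_left_mono)
    finally have "(p * exp (2 * l) + (1 - p)) ^ n * exp (- (2 * l * \<mu>)) \<le>
        exp (\<mu> * (2 * l + (2 * l)\<^sup>2)) * exp (- (2 * l * \<mu>))" by (rule mult_right_mono) simp
    also have "\<dots> = exp (4 * l\<^sup>2 * \<mu>)"
      by (simp add: algebra_simps power2_eq_square flip: exp_add)
    finally have "(\<Sum>s\<le>n. b s * exp (2 * l * (real s - \<mu>))) \<le> exp (4 * l\<^sup>2 * \<mu>)"
      unfolding mom .
    moreover have "exp (2 * l * (real s - \<mu>)) = (w s)\<^sup>2" for s
      by (simp add: w_def mult_ac flip: exp_double)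
    ultimately show ?thesis by simp
  qed
  have "(\<Sum>s\<le>n. b s * exp (l * max 0 (real s - \<mu>))) \<le> (\<Sum>s\<le>n. b s + sqrt (b s) * (sqrt (b s) * \<bar>w s - 1\<bar>))"
  proof (rule sum_mono)
    fix s
    have "exp (l * max 0 (real s - \<mu>)) \<le> 1 + \<bar>w s - 1\<bar>"
      unfolding w_def using l by (auto simp: max_def mult_nonneg_nonpos)
    then have "b s * exp (l * max 0 (real s - \<mu>)) \<le> b s * (1 + \<bar>w s - 1\<bar>)"
      using b0 by (rule mult_left_mono)
    also have "\<dots> = b s + sqrt (b s) * (sqrt (b s) * \<bar>w s - 1\<bar>)"
      using b0[of s] by (simp add: algebra_simps flip: mult.assoc)
    finally show "b s * exp (l * max 0 (real s - \<mu>)) \<le> b s + sqrt (b s) * (sqrt (b s) * \<bar>w s - 1\<bar>)" .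
  qed
  also have "\<dots> = 1 + (\<Sum>s\<le>n. sqrt (b s) * (sqrt (b s) * \<bar>w s - 1\<bar>))"
    by (simp add: sum.distrib b1)
  also have "(\<Sum>s\<le>n. sqrt (b s) * (sqrt (b s) * \<bar>w s - 1\<bar>)) \<le> sqrt (exp (4 * l\<^sup>2 * \<mu>) - 1)"
  proof (rule real_le_rsqrt)
    have "(\<Sum>s\<le>n. sqrt (b s) * (sqrt (b s) * \<bar>w s - 1\<bar>))\<^sup>2 \<le>
        (\<Sum>s\<le>n. (sqrt (b s))\<^sup>2) * (\<Sum>s\<le>n. (sqrt (b s) * \<bar>w s - 1\<bar>)\<^sup>2)"
      by (rule Cauchy_Schwarz_ineq_sum)
    also have "\<dots> = (\<Sum>s\<le>n. b s * (w s - 1)\<^sup>2)" using b0 b1 by (simp add: power_mult_distrib)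
    also have "\<dots> = (\<Sum>s\<le>n. b s * (w s)\<^sup>2) - 2 * (\<Sum>s\<le>n. b s * w s) + (\<Sum>s\<le>n. b s)"
      by (simp add: power2_eq_square algebra_simps sum.distrib sum_subtractf sum_distrib_left)
    also have "\<dots> \<le> exp (4 * l\<^sup>2 * \<mu>) - 1" using lower upper b1 by simp
    finally show "(\<Sum>s\<le>n. sqrt (b s) * (sqrt (b s) * \<bar>w s - 1\<bar>))\<^sup>2 \<le> exp (4 * l\<^sup>2 * \<mu>) - 1" .
  qed
  finally show ?thesis by (simp add: b_def \<mu>_def)
qed

text \<open>A geometric series without its constant term. Subtracting \<open>2 * y ^ Suc n\<close>
  strengthens the claim enough for induction, as \<open>2 * y \<le> 1\<close>.\<close>

lemma sum_powers_le:
  fixes y :: real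
  assumes "0 \<le> y" "y \<le> 1/2"
  shows "(\<Sum>s\<le>n. if s = 0 then 0 else y ^ s) \<le> 2 * y"
proof -
  have "(\<Sum>s\<le>n. if s = 0 then 0 else y ^ s) \<le> 2 * y - 2 * y ^ Suc n"
  proof (induction n)
    case (Suc n)
    have "2 * y * y ^ Suc n \<le> 1 * y ^ Suc n" using assms by (intro mult_right_mono) auto
    then show ?case using Suc by simp
  qed simp
  also have "\<dots> \<le> 2 * y" using assms by simp
  finally show ?thesis .
qed

section \<open>Small and large overlaps\<close>

context
  fixes n k t :: nat and D a A r :: real and N :: real and c :: "nat \<Rightarrow> real"
  defines "N \<equiv> D ^ k" and "c \<equiv> \<lambda>s. real (s choose k) / real (n choose k)"
  assumes D: "D \<ge> 2" and k: "k \<ge> 1" "k \<le> n" and A: "0 \<le> A" "A \<le> a" "A \<le> N - 1"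
    and r: "r > 0" and t: "real t \<le> r * real n * ln D"
begin

private lemma N_ge_2: "N \<ge> 2"
proof -
  have "D ^ 1 \<le> D ^ k" using D k by (intro power_increasing) auto
  then show ?thesis using D by (simp add: N_def)
qed

private lemma c_bounds:
  assumes "s \<le> n"
  shows "0 \<le> c s" "c s \<le> (real s / real n) ^ k" "(real s / real n) ^ k \<le> 1"
  using choose_quotient_le_power[OF assms k(2)] assms
  by (auto simp: c_def intro!: power_le_one divide_le_eq_1[THEN iffD2])

text \<open>Monotonicity of \<open>t\<close>-th powers requires this. The centered overlap is at
  least \<open>- 1 / (N - 1)\<close>, and \<open>A\<close> is at most \<open>N - 1\<close>.\<close>

private lemma base_nonneg:
  assumes "s \<le> n"
  shows "0 \<le> 1 + A * ((N * c s - 1) / (N - 1))"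
proof -
  have "-1 / (N - 1) \<le> (N * c s - 1) / (N - 1)"
    using N_ge_2 c_bounds(1)[OF assms] by (intro divide_right_mono) auto
  then have "A * (-1 / (N - 1)) \<le> A * ((N * c s - 1) / (N - 1))" using A(1) by (rule mult_left_mono)
  moreover have "A / (N - 1) \<le> 1" using A N_ge_2 by simp
  ultimately show ?thesis by simp
qed

text \<open>If \<open>c s\<close> is at most its mean \<open>1 / N\<close>, the left side is at most
  1. Otherwise use \<open>1 + y \<le> exp y\<close> and linearize: with \<open>x = s / n\<close>,
  the difference \<open>x ^ k - (1 / D) ^ k\<close> is at most \<open>k * z ^ (k - 1)\<close> times
  \<open>x - 1 / D\<close>.\<close>

private lemma small_overlap_term:
  assumes s: "s \<le> n" and z: "1 / D \<le> z" "real s \<le> real n * z"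
  shows "(1 + A * ((N * c s - 1) / (N - 1))) ^ t
    \<le> exp (2 * a * r * real k * ln D * z ^ (k - 1) * max 0 (real s - real n * (1 / D)))"
proof (cases "N * c s \<le> 1")
  case True
  have "A * ((N * c s - 1) / (N - 1)) \<le> 0"
    using True N_ge_2 A by (intro mult_nonneg_nonpos divide_nonpos_pos) auto
  then have "(1 + A * ((N * c s - 1) / (N - 1))) ^ t \<le> 1"
    using base_nonneg[OF s] by (intro power_le_one) auto
  also have "0 \<le> z" using z(1) D by (meson order_trans divide_nonneg_nonneg zero_le_one zero_le_numeral)
  then have "1 \<le> exp (2 * a * r * real k * ln D * z ^ (k - 1) * max 0 (real s - real n * (1 / D)))"
    using A r D by (auto intro!: mult_nonneg_nonneg)
  finally show ?thesis .
next
  case False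
  define x where "x = real s / real n"
  define Y where "Y = (N * c s - 1) / (N - 1)"
  have n: "n > 0" using k by simp
  have Y0: "Y \<ge> 0" using False N_ge_2 by (simp add: Y_def)
  have "N * c s - 1 > 0" using False by simp
  \<comment> \<open>Exceeding the mean \<open>1 / N\<close> forces \<open>x > 1 / D\<close>, so the
    positive part in the claim is not truncated.\<close>
  then have "(1 / D) ^ k < c s" using N_ge_2 by (simp add: N_def power_divide field_simps)
  also have "\<dots> \<le> x ^ k" using c_bounds(2)[OF s] by (simp add: x_def)
  finally have "1 / D < x" by (rule power_less_imp_less_base) (simp add: x_def)
  have xz: "x \<le> z" using z n by (simp add: x_def field_simps)
  \<comment> \<open>The factor 2 bounds \<open>N / (N - 1)\<close>.\<close>
  have "(N * c s - 1) / (N - 1) \<le> 2 * (c s - (1 / D) ^ k)"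
  proof -
    have "(N * c s - 1) \<le> (2 * N - 2) * ((N * c s - 1) / N)"
      using mult_right_mono[of N "2 * N - 2" "(N * c s - 1) / N"] N_ge_2 False by simp
    also have "(N * c s - 1) / N = c s - (1 / D) ^ k"
      using N_ge_2 D by (simp add: N_def power_divide field_simps)
    also have "(2 * N - 2) * (c s - (1 / D) ^ k) = 2 * (c s - (1 / D) ^ k) * (N - 1)"
      by (simp add: algebra_simps)
    finally show ?thesis using N_ge_2 by (subst pos_divide_le_eq) auto
  qed
  also have "\<dots> \<le> 2 * (x ^ k - (1 / D) ^ k)" using c_bounds(2)[OF s] by (simp add: x_def)
  also have "\<dots> \<le> 2 * (real k * z ^ (k - 1) * (x - 1 / D))"
    using \<open>1 / D < x\<close> D xz by (intro mult_left_mono power_diff_le_mult) auto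
  finally have Yle: "Y \<le> 2 * (real k * z ^ (k - 1) * (x - 1 / D))" by (simp add: Y_def)
  have "(1 + A * Y) ^ t \<le> exp (A * Y) ^ t"
    using base_nonneg[OF s] by (intro power_mono exp_ge_add_one_self) (simp add: Y_def)
  also have "\<dots> = exp (real t * (A * Y))" by (simp flip: exp_of_nat_mult)
  also have "\<dots> \<le> exp (r * real n * ln D * (a * (2 * (real k * z ^ (k - 1) * (x - 1 / D)))))"
    using t A Y0 Yle r D by (auto intro!: mult_mono)
  also have "r * real n * ln D * (a * (2 * (real k * z ^ (k - 1) * (x - 1 / D)))) =
      2 * a * r * real k * ln D * z ^ (k - 1) * (real n * (x - 1 / D))" by (simp add: mult_ac)
  also have "real n * (x - 1 / D) = max 0 (real s - real n * (1 / D))"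
  proof -
    have "real n * (x - 1 / D) = real s - real n * (1 / D)" using n by (simp add: x_def right_diff_distrib)
    moreover have "real n * (x - 1 / D) \<ge> 0" using \<open>1 / D < x\<close> by simp
    ultimately show ?thesis by simp
  qed
  finally show ?thesis by (simp add: Y_def)
qed

text \<open>With \<open>x = s / n\<close>, the binomial weight is at most
  \<open>(exp 1 / (x * D)) ^ s\<close> and the centered overlap at most \<open>x ^ k\<close>. The
  hypothesis bounds the sum of the two exponents by \<open>n * x * E = s * E\<close>.\<close>

private lemma large_overlap_term:
  assumes s: "1 \<le> s" "s \<le> n"
    and *: "\<And>x. z \<le> x \<Longrightarrow> x \<le> 1 \<Longrightarrow>
      x * (1 - ln x - ln D) + ln D * (r * ln (1 + a * x ^ k)) \<le> x * E"
    and z: "real n * z \<le> real s"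
  shows "real (n choose s) * (1 / D) ^ s * (1 - 1 / D) ^ (n - s) *
    (1 + A * ((N * c s - 1) / (N - 1))) ^ t \<le> exp E ^ s"
proof -
  define x where "x = real s / real n"
  have n: "n > 0" using k by simp
  have x: "0 < x" "x \<le> 1" "z \<le> x" using s z n by (auto simp: x_def field_simps)
  have xn: "real s = real n * x" using n by (simp add: x_def)
  have "real (n choose s) * (1 / D) ^ s * (1 - 1 / D) ^ (n - s) \<le> real (n choose s) * (1 / D) ^ s * 1"
    using D by (intro mult_left_mono power_le_one) auto
  also have "\<dots> \<le> (exp 1 * real n / real s) ^ s * (1 / D) ^ s"
    using binomial_le_exp_power[OF s(1), of n] D by (simp add: mult_right_mono)
  also have "\<dots> = (exp 1 / (x * D)) ^ s" using n D s by (simp add: x_def power_mult_distrib[symmetric])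
  also have "exp 1 / (x * D) = exp (1 - ln x - ln D)"
    using x D by (simp add: exp_diff)
  also have "exp (1 - ln x - ln D) ^ s = exp (real n * (x * (1 - ln x - ln D)))"
    by (simp add: xn mult.assoc flip: exp_of_nat_mult)
  finally have 1: "real (n choose s) * (1 / D) ^ s * (1 - 1 / D) ^ (n - s)
    \<le> exp (real n * (x * (1 - ln x - ln D)))" .
  have pos: "1 + a * x ^ k \<ge> 1" using A x by simp
  have "(N * c s - 1) / (N - 1) \<le> c s"
  proof -
    have "c s \<le> 1" using c_bounds[OF s(2)] by simp
    then show ?thesis using N_ge_2 by (simp add: pos_divide_le_eq algebra_simps)
  qed
  also have "\<dots> \<le> x ^ k" using c_bounds(2)[OF s(2)] by (simp add: x_def)
  finally have "A * ((N * c s - 1) / (N - 1)) \<le> A * x ^ k" using A(1) by (rule mult_left_mono)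
  also have "\<dots> \<le> a * x ^ k" using A x by (intro mult_right_mono) auto
  finally have "(1 + A * ((N * c s - 1) / (N - 1))) ^ t \<le> (1 + a * x ^ k) ^ t"
    using base_nonneg[OF s(2)] by (intro power_mono) auto
  also have "\<dots> = exp (real t * ln (1 + a * x ^ k))"
    using pos by (simp add: exp_of_nat_mult)
  also have "\<dots> \<le> exp (r * real n * ln D * ln (1 + a * x ^ k))"
    using t pos by (auto intro!: mult_right_mono)
  finally have 2: "(1 + A * ((N * c s - 1) / (N - 1))) ^ t \<le> exp (r * real n * ln D * ln (1 + a * x ^ k))" .
  have "real (n choose s) * (1 / D) ^ s * (1 - 1 / D) ^ (n - s) * (1 + A * ((N * c s - 1) / (N - 1))) ^ t
      \<le> exp (real n * (x * (1 - ln x - ln D))) * exp (r * real n * ln D * ln (1 + a * x ^ k))"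
    using base_nonneg[OF s(2)] by (intro mult_mono 1 2) auto
  also have "\<dots> = exp (real n * (x * (1 - ln x - ln D) + ln D * (r * ln (1 + a * x ^ k))))"
    by (simp add: algebra_simps flip: exp_add)
  also have "\<dots> \<le> exp (real n * (x * E))" using *[OF x(3,2)] by (simp add: mult_left_mono)
  also have "\<dots> = exp E ^ s" by (simp add: xn mult.assoc flip: exp_of_nat_mult)
  finally show ?thesis .
qed

text \<open>Split at overlap \<open>n * z\<close>: the smaller ones give an exponential moment of
  the binomial upper deviation, the larger ones a geometric series with ratio
  \<open>exp E\<close>.\<close>

lemma overlap_sum_le:
  assumes *: "\<And>x. z \<le> x \<Longrightarrow> x \<le> 1 \<Longrightarrow>
      x * (1 - ln x - ln D) + ln D * (r * ln (1 + a * x ^ k)) \<le> x * E"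
    and z: "1 / D \<le> z" and E: "exp E \<le> 1 / 2"
    and L: "2 * a * r * real k * ln D * z ^ (k - 1) \<le> 1 / 2"
  shows "(\<Sum>s\<le>n. real (n choose s) * (1 / D) ^ s * (1 - 1 / D) ^ (n - s) *
      (1 + A * ((N * c s - 1) / (N - 1))) ^ t)
    \<le> 1 + sqrt (exp (4 * (2 * a * r * real k * ln D * z ^ (k - 1))\<^sup>2 * (real n * (1 / D))) - 1) + 2 * exp E"
proof -
  let ?L = "2 * a * r * real k * ln D * z ^ (k - 1)"
  let ?b = "\<lambda>s. real (n choose s) * (1 / D) ^ s * (1 - 1 / D) ^ (n - s)"
  have z0: "z \<ge> 0" using z D by (meson order_trans divide_nonneg_nonneg zero_le_one zero_le_numeral)
  have L0: "?L \<ge> 0" using A r D z0 by (auto intro!: mult_nonneg_nonneg)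
  have b0: "?b s \<ge> 0" for s using D by auto
  \<comment> \<open>Both bounds are nonnegative, so their sum bounds every term and both sums may
    run over all \<open>s\<close>. As \<open>s = 0\<close> is always small, the geometric series
    omits it.\<close>
  have "(\<Sum>s\<le>n. ?b s * (1 + A * ((N * c s - 1) / (N - 1))) ^ t) \<le>
    (\<Sum>s\<le>n. ?b s * exp (?L * max 0 (real s - real n * (1 / D))) + (if s = 0 then 0 else exp E ^ s))"
  proof (rule sum_mono)
    fix s assume "s \<in> {..n}"
    then have s: "s \<le> n" by simp
    show "?b s * (1 + A * ((N * c s - 1) / (N - 1))) ^ t \<le>
      ?b s * exp (?L * max 0 (real s - real n * (1 / D))) + (if s = 0 then 0 else exp E ^ s)"
    proof (cases "real s \<le> real n * z")
      case True
      have "?b s * (1 + A * ((N * c s - 1) / (N - 1))) ^ t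
          \<le> ?b s * exp (?L * max 0 (real s - real n * (1 / D)))"
        using small_overlap_term[OF s z True] b0 by (rule mult_left_mono)
      moreover have "0 \<le> (if s = 0 then 0 else exp E ^ s)" by simp
      ultimately show ?thesis by linarith
    next
      case False
      then have "s \<ge> 1" using z0 by (cases s) auto
      have "?b s * (1 + A * ((N * c s - 1) / (N - 1))) ^ t \<le> exp E ^ s"
        by (rule large_overlap_term[OF \<open>s \<ge> 1\<close> s *]) (use False in auto)
      moreover have "0 \<le> ?b s * exp (?L * max 0 (real s - real n * (1 / D)))"
        by (rule mult_nonneg_nonneg[OF b0]) simp
      ultimately show ?thesis using \<open>s \<ge> 1\<close> by simp
    qed
  qed
  also have "\<dots> = (\<Sum>s\<le>n. ?b s * exp (?L * max 0 (real s - real n * (1 / D)))) +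
      (\<Sum>s\<le>n. if s = 0 then 0 else exp E ^ s)" by (rule sum.distrib)
  also have "\<dots> \<le> (1 + sqrt (exp (4 * ?L\<^sup>2 * (real n * (1 / D))) - 1)) + 2 * exp E"
    using D by (intro add_mono binomial_exp_upper_deviation sum_powers_le L L0 E) auto
  finally show ?thesis .
qed

end

subsection \<open>Limits\<close>

lemma filterlim_rb_d:
  assumes "\<alpha> > 0"
  shows "filterlim (\<lambda>n. real (rb_d \<alpha> n)) at_top sequentially"
proof (rule filterlim_at_top_mono)
  show "filterlim (\<lambda>n. real n powr \<alpha> - 1) at_top sequentially" using assms by real_asymp
  show "\<forall>\<^sub>F n in sequentially. real n powr \<alpha> - 1 \<le> real (rb_d \<alpha> n)"
    unfolding rb_d_def by (intro always_eventually allI) linarith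
qed

text \<open>Rounding loses at most a factor 2, since
  \<open>n powr \<alpha> < d + 1 \<le> 2 * d\<close>. This turns bounds in \<open>n\<close> into
  functions of the domain size alone.\<close>

lemma le_rb_d_powr:
  assumes "\<alpha> > 0" "rb_d \<alpha> n \<ge> 1"
  shows "real n \<le> (2 * real (rb_d \<alpha> n)) powr (1 / \<alpha>)"
proof -
  have "real n powr \<alpha> \<le> 2 * real (rb_d \<alpha> n)"
    using assms(2) unfolding rb_d_def by linarith
  then have "(real n powr \<alpha>) powr (1 / \<alpha>) \<le> (2 * real (rb_d \<alpha> n)) powr (1 / \<alpha>)"
    using assms(1) by (intro powr_mono2) auto
  then show ?thesis using assms(1) by (simp add: powr_powr)
qed

lemma rb_q_bounds:
  assumes "0 < p" "p < 1" "rb_d \<alpha> n \<ge> 1"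
  shows "rb_q \<alpha> k p n < rb_d \<alpha> n ^ k"
    and "real (rb_q \<alpha> k p n) \<le> p * real (rb_d \<alpha> n ^ k)"
    and "real (rb_q \<alpha> k p n) \<ge> p * real (rb_d \<alpha> n ^ k) - 1"
proof -
  have N: "real (rb_d \<alpha> n ^ k) > 0" using assms(3) by simp
  show le: "real (rb_q \<alpha> k p n) \<le> p * real (rb_d \<alpha> n ^ k)"
    unfolding rb_q_def using assms(1) by simp
  also have "\<dots> < 1 * real (rb_d \<alpha> n ^ k)" using N assms(2) by (rule mult_strict_right_mono[rotated])
  finally show "rb_q \<alpha> k p n < rb_d \<alpha> n ^ k" by simp
  show "real (rb_q \<alpha> k p n) \<ge> p * real (rb_d \<alpha> n ^ k) - 1"
    unfolding rb_q_def by simp linarith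
qed

lemma rb_t_bounds:
  assumes "r > 0" "rb_d \<alpha> n \<ge> 1"
  shows "real (rb_t \<alpha> r n) \<le> r * real n * ln (real (rb_d \<alpha> n))"
    and "real (rb_t \<alpha> r n) \<ge> r * real n * ln (real (rb_d \<alpha> n)) - 1"
proof -
  have "r * real n * ln (real (rb_d \<alpha> n)) \<ge> 0" using assms by simp
  then show "real (rb_t \<alpha> r n) \<le> r * real n * ln (real (rb_d \<alpha> n))"
    "real (rb_t \<alpha> r n) \<ge> r * real n * ln (real (rb_d \<alpha> n)) - 1"
    unfolding rb_t_def by linarith+
qed

text \<open>The logarithm of the expected number of solutions is about
  \<open>n * ln d * (1 + r * ln (1 - p))\<close>, and above the threshold the last factor is
  negative.\<close>

lemma rb_prob_sat_tendsto_0: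
  assumes k: "k \<ge> 1" and \<alpha>: "\<alpha> > 0" and r: "r > 0" and p: "0 < p" "p < 1"
    and p_gt: "p > 1 - 1 / exp (1 / r)"
  shows "(\<lambda>n. rb_prob_sat n \<alpha> r k p) \<longlonglongrightarrow> 0"
proof -
  \<comment> \<open>A smaller value still above the threshold absorbs the rounding of
    \<open>q\<close> once the domain is large.\<close>
  obtain p' where p': "1 - 1 / exp (1 / r) < p'" "p' < p" using dense[OF p_gt] by blast
  define c where "c = - (1 + r * ln (1 - p'))"
  let ?D = "\<lambda>n. real (rb_d \<alpha> n)"
  have "ln (1 - p') < ln (exp (- 1 / r))"
    using p' p by (subst ln_less_cancel_iff) (auto simp: exp_minus field_simps)
  then have c: "c > 0" using r by (simp add: c_def field_simps)
  have large: "\<forall>\<^sub>F n in sequentially. ?D n \<ge> max 2 (1 / (p - p'))"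
    using filterlim_rb_d[OF \<alpha>] unfolding filterlim_at_top by blast
  have bound: "\<forall>\<^sub>F n in sequentially.
      rb_prob_sat n \<alpha> r k p \<le> exp (- c * (real n * ln (?D n)) - ln (1 - p'))"
    using large eventually_ge_at_top[of k]
  proof eventually_elim
    case (elim n)
    let ?N = "real (rb_d \<alpha> n ^ k)" and ?q = "real (rb_q \<alpha> k p n)"
    have D: "?D n \<ge> 2" "rb_d \<alpha> n \<ge> 1" "?D n \<ge> 1 / (p - p')" using elim(1) by auto
    have "?D n ^ 1 \<le> ?D n ^ k" using D k by (intro power_increasing) auto
    then have N: "?N \<ge> ?D n" by simp
    have "1 \<le> (p - p') * ?D n" using D(3) p' by (simp add: pos_divide_le_eq mult.commute)
    also have "\<dots> \<le> (p - p') * ?N" using N p' by (intro mult_left_mono) auto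
    finally have "?N - ?q \<le> (1 - p') * ?N"
      using rb_q_bounds(3)[OF p D(2), of k] by (simp add: algebra_simps)
    then have u: "(?N - ?q) / ?N \<le> 1 - p'" using N D by (subst pos_divide_le_eq) auto
    have "rb_prob_sat n \<alpha> r k p \<le> ?D n ^ n * ((?N - ?q) / ?N) ^ rb_t \<alpha> r n"
      using elim(2) rb_q_bounds(1)[OF p D(2)] by (rule rb_prob_sat_le)
    also have "\<dots> \<le> ?D n ^ n * (1 - p') ^ rb_t \<alpha> r n"
      using u rb_q_bounds(1)[OF p D(2), of k] N D
      by (intro mult_left_mono power_mono) (auto intro!: divide_nonneg_nonneg simp flip: of_nat_power)
    also have "\<dots> = exp (real n * ln (?D n) + real (rb_t \<alpha> r n) * ln (1 - p'))"
      using D p p' by (simp add: exp_add exp_of_nat_mult)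
    \<comment> \<open>As \<open>ln (1 - p')\<close> is nonpositive, the lower bound on
      \<open>t\<close> applies; its rounding leaves a constant.\<close>
    also have "\<dots> \<le> exp (real n * ln (?D n) + (r * real n * ln (?D n) - 1) * ln (1 - p'))"
    proof -
      have "p' > 0"
        using p'(1) r by (smt (verit) one_le_exp_iff divide_le_eq_1 exp_gt_zero zero_le_divide_1_iff)
      then have "ln (1 - p') \<le> 0" using p' p by simp
      then show ?thesis using rb_t_bounds(2)[OF r D(2)] by (auto intro!: mult_right_mono_neg)
    qed
    also have "\<dots> = exp (- c * (real n * ln (?D n)) - ln (1 - p'))"
      by (simp add: c_def algebra_simps)
    finally show ?case .
  qed
  have "filterlim (\<lambda>n. real n * ln (?D n)) at_top sequentially"
    by (intro filterlim_at_top_mult_at_top filterlim_real_sequentially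
        filterlim_compose[OF ln_at_top filterlim_rb_d[OF \<alpha>]])
  moreover have "((\<lambda>y. exp (- c * y - ln (1 - p'))) \<longlongrightarrow> 0) at_top" using c by real_asymp
  ultimately have "(\<lambda>n. exp (- c * (real n * ln (?D n)) - ln (1 - p'))) \<longlonglongrightarrow> 0"
    by (rule filterlim_compose[rotated])
  then show ?thesis
    by (intro tendsto_sandwich[OF _ bound tendsto_const]) (auto simp: rb_prob_sat_def)
qed

text \<open>The two exponents are those of \<open>\<mu> * \<lambda>\<^sup>2\<close> for the mean overlap \<open>\<mu> = n / D\<close> and the slope
  \<open>\<lambda>\<close> of the linearized exponent: this is where \<open>(2 * k - 1) * \<alpha> > 1\<close> enters.\<close>

lemma overlap_bound_tendsto_1:
  fixes K u v C \<delta> :: real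
  assumes u: "u > 0" and v: "v < 1 + 2 * u" and \<delta>: "\<delta> > 0"
  shows "((\<lambda>D. 1 + sqrt (exp (4 * (K * ln D * D powr - u)\<^sup>2 * ((2 * D) powr v * (1 / D))) - 1)
    + 2 * exp (C - \<delta> * ln D)) \<longlongrightarrow> 1) at_top"
proof -
  \<comment> \<open>Collecting powers, the argument of \<open>exp\<close> under the root is a
    constant times \<open>(ln D)\<^sup>2 * D powr - w\<close>.\<close>
  define w where "w = 1 + 2 * u - v"
  have w: "w > 0" using v by (simp add: w_def)
  have "((\<lambda>D. 4 * K\<^sup>2 * 2 powr v * ((ln D)\<^sup>2 * D powr - w)) \<longlongrightarrow> 4 * K\<^sup>2 * 2 powr v * 0) at_top"
    by (intro tendsto_intros) (use w in real_asymp)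
  moreover have "\<forall>\<^sub>F D in at_top. 4 * K\<^sup>2 * 2 powr v * ((ln D)\<^sup>2 * D powr - w) =
      4 * (K * ln D * D powr - u)\<^sup>2 * ((2 * D) powr v * (1 / D))"
    using eventually_gt_at_top[of 0]
  proof eventually_elim
    case (elim D)
    have "- w = - u + - u + v + - 1" by (simp add: w_def)
    then have "D powr - w = D powr (- u) * D powr (- u) * D powr v * D powr (- 1)"
      by (simp only: powr_add)
    also have "D powr (- 1) = 1 / D" using elim by (simp add: powr_minus_divide)
    finally show ?case using elim by (simp add: powr_mult power2_eq_square)
  qed
  ultimately have 1: "((\<lambda>D. 4 * (K * ln D * D powr - u)\<^sup>2 * ((2 * D) powr v * (1 / D))) \<longlongrightarrow> 0) at_top"
    by (simp add: tendsto_cong)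
  have 2: "((\<lambda>D. exp (C - \<delta> * ln D)) \<longlongrightarrow> 0) at_top" using \<delta> by real_asymp
  have "((\<lambda>D. 1 + sqrt (exp (4 * (K * ln D * D powr - u)\<^sup>2 * ((2 * D) powr v * (1 / D))) - 1)
    + 2 * exp (C - \<delta> * ln D)) \<longlongrightarrow> 1 + sqrt (exp 0 - 1) + 2 * 0) at_top"
    by (intro tendsto_add tendsto_mult tendsto_real_sqrt tendsto_diff tendsto_exp tendsto_const 1 2)
  then show ?thesis by simp
qed

text \<open>The probability is squeezed between the second moment bound and 1. Overlaps are cut at
  \<open>n * D powr (\<eta> - 1)\<close>: \<eta> is positive to make large overlaps negligible, and
  small enough for the deviation bound on the others.\<close>

lemma rb_prob_sat_tendsto_1:
  assumes k: "k \<ge> 2" and \<alpha>: "\<alpha> > 0" and r: "r > 0" and p: "0 < p" "p < 1"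
    and k\<alpha>: "(2 * real k - 1) * \<alpha> > 1"
    and kr: "real k \<ge> exp (1 / r) * ln (exp (1 / r)) / (exp (1 / r) - 1)"
    and p_less: "p < 1 - 1 / exp (1 / r)"
  shows "(\<lambda>n. rb_prob_sat n \<alpha> r k p) \<longlonglongrightarrow> 1"
proof -
  \<comment> \<open>An upper bound for \<open>q / (N - q)\<close>. Being below the threshold means
    exactly \<open>a < exp (1 / r) - 1\<close>.\<close>
  define a where "a = p / (1 - p)"
  have "1 / exp (1 / r) < 1 - p" using p_less by simp
  then have "1 < (1 - p) * exp (1 / r)" by (simp add: pos_divide_less_eq)
  then have "p < (1 - p) * (exp (1 / r) - 1)" by (simp add: algebra_simps)
  then have a: "0 < a" "a < exp (1 / r) - 1" using p by (auto simp: a_def field_simps)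
  \<comment> \<open>Positive exactly when \<open>(2 * k - 1) * \<alpha> > 1\<close>.\<close>
  define g where "g = 2 * real k - 1 - 1 / \<alpha>"
  have g: "g > 0" using k\<alpha> \<alpha> by (simp add: g_def field_simps)
  \<comment> \<open>Keeps \<open>2 * \<eta> * (k - 1)\<close> at most \<open>g / 2\<close>; the cap
    1/2 keeps \<eta> below 1.\<close>
  define \<eta> where "\<eta> = min (1 / 2) (g / (4 * (real k - 1)))"
  have k1: "real k - 1 > 0" using k by simp
  have \<eta>: "0 < \<eta>" "\<eta> < 1" using g k1 by (auto simp: \<eta>_def)
  have "\<eta> * (4 * (real k - 1)) \<le> g / (4 * (real k - 1)) * (4 * (real k - 1))"
    using k1 by (intro mult_right_mono) (auto simp: \<eta>_def)
  then have "\<eta> * (4 * (real k - 1)) \<le> g" using k1 by simp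
  then have \<eta>g: "2 * \<eta> * (real k - 1) < g" using g by (simp add: algebra_simps)
  \<comment> \<open>\<open>D powr - u\<close> is the cutoff \<open>D powr (\<eta> - 1)\<close>
    raised to the power \<open>k - 1\<close>.\<close>
  define u where "u = (1 - \<eta>) * (real k - 1)"
  have u: "u > 0" using \<eta> k1 by (simp add: u_def)
  have v: "1 / \<alpha> < 1 + 2 * u" using \<eta>g by (simp add: u_def g_def algebra_simps)
  obtain \<delta>0 where "\<delta>0 > 0" "\<And>x. 0 \<le> x \<Longrightarrow> x \<le> 1 \<Longrightarrow> r * ln (1 + a * x ^ k) \<le> (1 - \<delta>0) * x"
    using ln_one_plus_power_uniform[OF r k a kr] by blast
  from large_overlap_exponent[OF r k a(1) \<eta> this] obtain \<delta> C where \<delta>: "\<delta> > 0"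
    and exponent: "\<And>D x. D \<ge> 1 \<Longrightarrow> D powr (\<eta> - 1) \<le> x \<Longrightarrow> x \<le> 1 \<Longrightarrow>
      x * (1 - ln x - ln D) + ln D * (r * ln (1 + a * x ^ k)) \<le> x * (C - \<delta> * ln D)" by metis
  define K where "K = 2 * a * r * real k"
  \<comment> \<open>The bound of \<open>overlap_sum_le\<close> with \<open>n\<close> replaced by
    \<open>(2 * D) powr (1 / \<alpha>)\<close>, hence a function of \<open>D\<close> alone.\<close>
  define F where "F = (\<lambda>D. 1 + sqrt (exp (4 * (K * ln D * D powr - u)\<^sup>2 *
    ((2 * D) powr (1 / \<alpha>) * (1 / D))) - 1) + 2 * exp (C - \<delta> * ln D))"
  let ?D = "\<lambda>n. real (rb_d \<alpha> n)"
  have "((\<lambda>D. exp (C - \<delta> * ln D)) \<longlongrightarrow> 0) at_top" using \<delta> by real_asymp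
  then have "\<forall>\<^sub>F D in at_top. exp (C - \<delta> * ln D) < 1 / 2" by (rule order_tendstoD) simp
  moreover have "((\<lambda>D. K * ln D * D powr - u) \<longlongrightarrow> 0) at_top" using u by real_asymp
  then have "\<forall>\<^sub>F D in at_top. K * ln D * D powr - u < 1 / 2" by (rule order_tendstoD) simp
  ultimately have "\<forall>\<^sub>F D in at_top. exp (C - \<delta> * ln D) < 1 / 2 \<and> K * ln D * D powr - u < 1 / 2 \<and> D \<ge> 2"
    using eventually_ge_at_top[of 2] by eventually_elim simp
  then have large: "\<forall>\<^sub>F n in sequentially. exp (C - \<delta> * ln (?D n)) < 1 / 2 \<and>
      K * ln (?D n) * ?D n powr - u < 1 / 2 \<and> ?D n \<ge> 2"
    by (rule eventually_compose_filterlim[OF _ filterlim_rb_d[OF \<alpha>]])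
  have bound: "\<forall>\<^sub>F n in sequentially. 2 - F (?D n) \<le> rb_prob_sat n \<alpha> r k p"
    using large eventually_ge_at_top[of k]
  proof eventually_elim
    case (elim n)
    let ?N = "real (rb_d \<alpha> n ^ k)" and ?q = "real (rb_q \<alpha> k p n)"
    let ?z = "?D n powr (\<eta> - 1)"
    have D: "?D n \<ge> 2" "rb_d \<alpha> n \<ge> 2" "rb_d \<alpha> n \<ge> 1" using elim(1) by auto
    note q = rb_q_bounds[OF p D(3), of k]
    have Nq: "?q + 1 \<le> ?N" using q(1) by (metis Suc_eq_plus1 Suc_leI of_nat_1 of_nat_add of_nat_le_iff)
    have A0: "0 \<le> ?q / (?N - ?q)"
      by (rule divide_nonneg_nonneg) (use Nq in linarith)+
    have A1: "?q / (?N - ?q) \<le> a"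
    proof -
      have "?q * (1 - p) \<le> p * (?N - ?q)" using q(2) by (simp add: algebra_simps)
      moreover have pos: "?N - ?q > 0" "1 - p > 0" using Nq p by linarith+
      ultimately show ?thesis
        by (simp only: a_def pos_le_divide_eq[OF pos(2)] times_divide_eq_left pos_divide_le_eq[OF pos(1)])
    qed
    have A2: "?q / (?N - ?q) \<le> ?N - 1"
    proof -
      have "?q / (?N - ?q) \<le> ?q / 1" using Nq q(1) by (intro divide_left_mono) auto
      then show ?thesis using Nq by simp
    qed
    \<comment> \<open>The cutoff is not below the mean \<open>1 / D\<close>, because \<eta> is
      positive.\<close>
    have z: "1 / ?D n \<le> ?z"
    proof -
      have "?D n powr (-1) \<le> ?z" using D \<eta> by (intro powr_mono) auto
      then show ?thesis using D by (simp add: powr_minus_divide)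
    qed
    have zk: "?z ^ (k - 1) = ?D n powr - u"
      using D k by (simp add: u_def powr_powr of_nat_diff algebra_simps flip: powr_realpow)
    have L: "2 * a * r * real k * ln (?D n) * ?z ^ (k - 1) = K * ln (?D n) * ?D n powr - u"
      by (simp only: zk K_def)
    have "2 - rb_prob_sat n \<alpha> r k p \<le>
        (\<Sum>s\<le>n. real (n choose s) * (1 / ?D n) ^ s * (1 - 1 / ?D n) ^ (n - s) *
      (1 + ?q / (?N - ?q) * ((?N * (real (s choose k) / real (n choose k)) - 1) / (?N - 1))) ^ rb_t \<alpha> r n)"
      using rb_prob_sat_ge[OF elim(2) q(1) D(2), of r] k by simp
    also have "\<dots> \<le> 1 + sqrt (exp (4 * (K * ln (?D n) * ?D n powr - u)\<^sup>2 * (real n * (1 / ?D n))) - 1) +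
        2 * exp (C - \<delta> * ln (?D n))"
      using overlap_sum_le[of "?D n" k n "?q / (?N - ?q)" a r "rb_t \<alpha> r n" ?z "C - \<delta> * ln (?D n)",
          unfolded L, OF D(1) _ elim(2) A0 A1 _ r rb_t_bounds(1)[OF r D(3)] exponent z] A2 elim(1) D k by simp
    also have "\<dots> \<le> F (?D n)"
      unfolding F_def using le_rb_d_powr[OF \<alpha> D(3)] D
      by (intro add_mono order_refl real_sqrt_le_mono diff_right_mono iffD2[OF exp_le_cancel_iff]
          mult_left_mono mult_right_mono) auto
    finally show ?case by simp
  qed
  have "(F \<longlongrightarrow> 1) at_top" unfolding F_def by (rule overlap_bound_tendsto_1[OF u v \<delta>])
  then have "(\<lambda>n. F (?D n)) \<longlonglongrightarrow> 1" by (rule filterlim_compose[OF _ filterlim_rb_d[OF \<alpha>]])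
  then have "(\<lambda>n. 2 - F (?D n)) \<longlonglongrightarrow> 2 - 1" by (intro tendsto_diff tendsto_const)
  then show ?thesis
    by (intro tendsto_sandwich[OF bound _ _ tendsto_const]) (auto simp: rb_prob_sat_def)
qed

theorem theorem3p2:
  fixes k :: nat and \<alpha> r p :: real
  assumes "k \<ge> 2" and "\<alpha> > 0" and "r > 0" and "0 < p" and "p < 1"
    and "(2 * real k - 1) * \<alpha> > 1"
    and "real k \<ge> exp (1 / r) * ln (exp (1 / r)) / (exp (1 / r) - 1)"
  shows "(p < 1 - 1 / exp (1 / r) \<longrightarrow> ((\<lambda>n. rb_prob_sat n \<alpha> r k p) \<longlonglongrightarrow> 1))
       \<and> (p > 1 - 1 / exp (1 / r) \<longrightarrow> ((\<lambda>n. rb_prob_sat n \<alpha> r k p) \<longlonglongrightarrow> 0))"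
  using assms by (intro conjI impI rb_prob_sat_tendsto_1 rb_prob_sat_tendsto_0) auto

end
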